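(* Let $p\in[0,1]$ be such that there exist $\epsilon>0$ and $c<\frac{1-\epsilon}{1-p}$ such that random instances of $(2+p)$-SAT with $n$ variables and $cn$ clauses are unsatisfiable with probability tending to $1$. Then $(2+p)$-SAT has a first-order phase transition.
   Context: Random $(2+p)$-SAT: for fixed $p\in[0,1]$, a random instance with $n$ variables and $m$ clauses consists of $pm$ clauses of length $3$ and $(1-p)m$ clauses of length $2$, each chosen independently and uniformly at random among clauses on distinct variables. Spine of a CNF formula $\Phi$: the set of literals $x$ such that some satisfiable subformula $\Xi\subseteq\Phi$ has $\Xi\wedge\{\overline{x}\}$ unsatisfiable. $(2+p)$-SAT has a first-order phase transition if there exists $\eta>0$ such that for every sequence $m=m(n)$, with $\Phi$ a random instance with $n$ variables and $m(n)$ clauses, $\lim_n\Pr[\Phi\text{ satisfiable}]=0$ implies $\lim_n\Pr[|Spine(\Phi)|/n\geq\eta]=1$. *)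

theory Defs
  imports "HOL-Probability.Probability"
begin

datatype literal = Pos nat | Neg nat

fun var :: "literal \<Rightarrow> nat" where
  "var (Pos v) = v"
| "var (Neg v) = v"

fun negate :: "literal \<Rightarrow> literal" where
  "negate (Pos v) = Neg v"
| "negate (Neg v) = Pos v"

fun lit_true :: "(nat \<Rightarrow> bool) \<Rightarrow> literal \<Rightarrow> bool" where
  "lit_true \<sigma> (Pos v) \<longleftrightarrow> \<sigma> v"
| "lit_true \<sigma> (Neg v) \<longleftrightarrow> \<not> \<sigma> v"

type_synonym clause = "literal set"

type_synonym cnf = "clause set"

definition satisfiable :: "cnf \<Rightarrow> bool" where
  "satisfiable \<Phi> \<longleftrightarrow> (\<exists>\<sigma>. \<forall>C\<in>\<Phi>. \<exists>l\<in>C. lit_true \<sigma> l)"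

definition Spine :: "cnf \<Rightarrow> literal set" where
  "Spine \<Phi> = {x. \<exists>\<Xi>\<subseteq>\<Phi>. satisfiable \<Xi> \<and> \<not> satisfiable (insert {negate x} \<Xi>)}"

definition clauses :: "nat \<Rightarrow> nat \<Rightarrow> clause set" where
  "clauses n k = {C. card C = k \<and> inj_on var C \<and> var ` C \<subseteq> {..<n}}"

text \<open>
  An instance is a list of exactly \<open>m\<close> independent clauses (repetitions allowed), with the
  non-integral number \<open>p m\<close> of 3-clauses rounded down and the remaining clauses having length 2.
  As a CNF formula it is the set of its entries.  For \<open>n < 3\<close> the set \<open>clauses n 3\<close> is empty and
  \<open>pmf_of_set\<close> is unspecified; only limits as \<open>n\<close> tends to infinity are used below.
\<close>

definition random_instance :: "real \<Rightarrow> nat \<Rightarrow> nat \<Rightarrow> clause list pmf" where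
  "random_instance p n m =
    (let k = nat \<lfloor>p * real m\<rfloor> in
     map_pmf (\<lambda>(xs, ys). xs @ ys)
       (pair_pmf (replicate_pmf k (pmf_of_set (clauses n 3)))
                 (replicate_pmf (m - k) (pmf_of_set (clauses n 2)))))"

definition first_order_phase_transition :: "real \<Rightarrow> bool" where
  "first_order_phase_transition p \<longleftrightarrow>
    (\<exists>\<eta>>0. \<forall>m :: nat \<Rightarrow> nat.
      (\<lambda>n. measure_pmf.prob (random_instance p n (m n))
              {\<Phi>. satisfiable (set \<Phi>)}) \<longlonglongrightarrow> 0 \<longrightarrow>
      (\<lambda>n. measure_pmf.prob (random_instance p n (m n))
              {\<Phi>. real (card (Spine (set \<Phi>))) / real n \<ge> \<eta>}) \<longlonglongrightarrow> 1)"

end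

theory Submission
  imports Defs "HOL-Library.Sublist"
begin

text \<open>
  The complement of each literal of a minimally unsatisfiable subformula lies in the spine, so it
  suffices to exclude minimally unsatisfiable subformulas on fewer than \<open>\<eta> n\<close> variables.  In such a
  subformula with \<open>r\<close> 3-clauses, let the core \<open>K\<close> consist of the variables that lie in a 3-clause or
  occur at least three times, and let \<open>k = card K\<close>.  Outside \<open>K\<close> each literal occurs exactly once, so
  the non-core variables merely subdivide implications; if there are \<open>u\<close> of them and \<open>u + g\<close>
  2-clauses, contracting these chains leaves \<open>g\<close> segments.  Since the density of 2-clauses is below 1,
  summing over \<open>u\<close> is a convergent series costing a constant factor per segment.  What remains has
  expected number about \<open>(C k / n) ^ (g + 2 r - k)\<close>.  Tarsi's lemma (more clauses than variables) gives
  \<open>g + r > k\<close> and counting occurrences gives \<open>3 k \<le> 2 g + 6 r\<close>, so the exponent is positive and of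
  order \<open>k + g + r\<close>; for small \<open>k / n\<close> the total is \<open>O(1 / n)\<close>.
\<close>

section \<open>Minimally unsatisfiable formulas and the spine\<close>

text \<open>Hall's marriage theorem by induction on the index set. If some nonempty proper subfamily
  is tight, it and the rest are matched separately. Otherwise every nonempty proper subfamily has an
  element to spare, so one index may take any of its elements.\<close>

lemma hall_matching:
  assumes "finite I" "\<And>i. i \<in> I \<Longrightarrow> finite (A i)"
    and "\<And>J. J \<subseteq> I \<Longrightarrow> card J \<le> card (\<Union>(A ` J))"
  shows "\<exists>f. inj_on f I \<and> (\<forall>i\<in>I. f i \<in> A i)"
  using assms
proof (induction "card I" arbitrary: I A rule: less_induct)
  case less
  note fin = less.prems(1) and finA = less.prems(2) and hall = less.prems(3)
  show ?case
  proof (cases "\<exists>J. J \<subset> I \<and> J \<noteq> {} \<and> card J = card (\<Union>(A ` J))")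
    case True
    then obtain J where J: "J \<subset> I" "J \<noteq> {}" "card J = card (\<Union>(A ` J))" by blast
    have finJ: "finite J" using J fin finite_subset by blast
    have "card J < card I" using J(1) fin by (rule psubset_card_mono[rotated])
    then have "\<exists>f. inj_on f J \<and> (\<forall>i\<in>J. f i \<in> A i)"
      using J finJ finA hall by (intro less.hyps) auto
    then obtain f where f: "inj_on f J" "\<And>i. i \<in> J \<Longrightarrow> f i \<in> A i" by blast
    let ?B = "\<lambda>i. A i - \<Union>(A ` J)"
    have "card (I - J) < card I"
      using J fin by (intro psubset_card_mono) auto
    \<comment> \<open>Hall's condition survives removal of the elements next to \<open>J\<close>:
      apply it to \<open>J \<union> L\<close> and cancel the tight equality for
      \<open>J\<close>.\<close>
    moreover have "card L \<le> card (\<Union>(?B ` L))" if L: "L \<subseteq> I - J" for L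
    proof -
      have finL: "finite L" using L fin finite_subset by blast
      have "card J + card L = card (J \<union> L)"
        using L finJ finL by (intro card_Un_disjoint[symmetric]) auto
      also have "\<dots> \<le> card (\<Union>(A ` (J \<union> L)))" using L J by (intro hall) auto
      also have "\<Union>(A ` (J \<union> L)) = \<Union>(A ` J) \<union> \<Union>(?B ` L)" by auto
      also have "card \<dots> \<le> card (\<Union>(A ` J)) + card (\<Union>(?B ` L))" by (rule card_Un_le)
      finally show ?thesis using J by simp
    qed
    ultimately have "\<exists>g. inj_on g (I - J) \<and> (\<forall>i\<in>I - J. g i \<in> ?B i)"
      using fin finA by (intro less.hyps) auto
    then obtain g where g: "inj_on g (I - J)" "\<And>i. i \<in> I - J \<Longrightarrow> g i \<in> ?B i" by blast
    let ?h = "\<lambda>i. if i \<in> J then f i else g i"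
    have "inj_on ?h I"
    proof (rule inj_onI)
      fix x y assume xy: "x \<in> I" "y \<in> I" "?h x = ?h y"
      show "x = y"
        using xy f(2)[of x] f(2)[of y] g(2)[of x] g(2)[of y]
          inj_onD[OF f(1), of x y] inj_onD[OF g(1), of x y]
        by (cases "x \<in> J"; cases "y \<in> J") auto
    qed
    moreover have "\<forall>i\<in>I. ?h i \<in> A i" using f g by auto
    ultimately show ?thesis by blast
  next
    case False
    show ?thesis
    proof (cases "I = {}")
      case False
      then obtain i where i: "i \<in> I" by blast
      have "A i \<noteq> {}" using hall[of "{i}"] i by auto
      then obtain x where x: "x \<in> A i" by blast
      let ?B = "\<lambda>j. A j - {x}"
      have "card (I - {i}) < card I" using i fin by (intro psubset_card_mono) auto
      \<comment> \<open>Without tight subfamilies the inequality for \<open>J\<close> is strict,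
        which pays for the loss of \<open>x\<close>.\<close>
      moreover have "card J \<le> card (\<Union>(?B ` J))" if J: "J \<subseteq> I - {i}" for J
      proof (cases "J = {}")
        case False
        have "J \<subset> I" using J i by auto
        then have "card J < card (\<Union>(A ` J))"
          using \<open>\<nexists>J. _ J\<close> hall[of J] False by (metis le_neq_implies_less psubset_imp_subset)
        moreover have "\<Union>(?B ` J) = \<Union>(A ` J) - {x}" by auto
        ultimately show ?thesis
          by (metis Suc_leI Suc_le_eq card_Diff_singleton_if diff_Suc_1 diff_le_mono less_imp_le_nat)
      qed auto
      ultimately have "\<exists>g. inj_on g (I - {i}) \<and> (\<forall>j\<in>I - {i}. g j \<in> ?B j)"
        using fin finA by (intro less.hyps) auto
      then obtain g where g: "inj_on g (I - {i})" "\<And>j. j \<in> I - {i} \<Longrightarrow> g j \<in> ?B j" by blast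
      have "inj_on (g(i := x)) I"
      proof (rule inj_onI)
        fix a b assume "a \<in> I" "b \<in> I" "(g(i := x)) a = (g(i := x)) b"
        then show "a = b"
          using g(2)[of a] g(2)[of b] inj_onD[OF g(1), of a b]
          by (cases "a = i"; cases "b = i") auto
      qed
      moreover have "\<forall>j\<in>I. (g(i := x)) j \<in> A j" using g x by auto
      ultimately show ?thesis by blast
    qed auto
  qed
qed

section \<open>Variables, assignments and literals\<close>

definition vars :: "cnf \<Rightarrow> nat set" where
  "vars \<Phi> = (\<Union>C\<in>\<Phi>. var ` C)"

definition satisfies :: "(nat \<Rightarrow> bool) \<Rightarrow> cnf \<Rightarrow> bool" where
  "satisfies \<sigma> \<Phi> \<longleftrightarrow> (\<forall>C\<in>\<Phi>. \<exists>l\<in>C. lit_true \<sigma> l)"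

lemma satisfiable_iff: "satisfiable \<Phi> \<longleftrightarrow> (\<exists>\<sigma>. satisfies \<sigma> \<Phi>)"
  by (simp add: satisfiable_def satisfies_def)

lemma lit_true_cong: "\<sigma> (var l) = \<tau> (var l) \<Longrightarrow> lit_true \<sigma> l = lit_true \<tau> l"
  by (cases l) auto

text \<open>\<open>lit_true (\<lambda>_. True) l\<close> is the sign of \<open>l\<close>, hence the
  value its variable must take to make \<open>l\<close> true.\<close>

lemma lit_true_upd: "lit_true (\<sigma>(var l := lit_true (\<lambda>_. True) l)) l"
  by (cases l) auto

lemma var_negate [simp]: "var (negate l) = var l"
  by (cases l) auto

lemma negate_negate [simp]: "negate (negate l) = l"
  by (cases l) auto

lemma lit_true_negate [simp]: "lit_true \<sigma> (negate l) \<longleftrightarrow> \<not> lit_true \<sigma> l"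
  by (cases l) auto

lemma var_eq_iff: "var l = var l' \<longleftrightarrow> l = l' \<or> l = negate l'"
  by (cases l; cases l') auto

lemma negate_neq [simp]: "negate l \<noteq> l"
  by (cases l) auto

text \<open>Each clause is made true through its own matched variable. These variables are distinct
  and lie outside \<open>W\<close>, so the choices neither conflict nor disturb
  \<open>\<tau>\<close> on \<open>W\<close>.\<close>

lemma satisfies_matching:
  assumes "inj_on f \<Phi>" and "\<forall>C\<in>\<Phi>. f C \<in> var ` C - W"
  shows "\<exists>\<sigma>. (\<forall>v\<in>W. \<sigma> v = \<tau> v) \<and> satisfies \<sigma> \<Phi>"
proof -
  have "\<forall>C\<in>\<Phi>. \<exists>l\<in>C. f C = var l" using assms(2) by blast
  then obtain g where g: "\<And>C. C \<in> \<Phi> \<Longrightarrow> g C \<in> C \<and> f C = var (g C)" by metis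
  define \<sigma> where "\<sigma> v = (if v \<in> f ` \<Phi> then lit_true (\<lambda>_. True) (g (inv_into \<Phi> f v)) else \<tau> v)" for v
  have "lit_true \<sigma> (g C)" if C: "C \<in> \<Phi>" for C
  proof -
    have "inv_into \<Phi> f (var (g C)) = C" using g[OF C] inv_into_f_f[OF assms(1) C] by simp
    then have "\<sigma> (var (g C)) = lit_true (\<lambda>_. True) (g C)"
      using g[OF C] C unfolding \<sigma>_def by (metis (no_types) image_eqI)
    then show ?thesis by (cases "g C") auto
  qed
  moreover have "\<sigma> v = \<tau> v" if "v \<in> W" for v
    using that assms(2) unfolding \<sigma>_def by auto
  ultimately show ?thesis using g unfolding satisfies_def by blast
qed

section \<open>Minimal unsatisfiability and Tarsi's lemma\<close>

definition min_unsat :: "cnf \<Rightarrow> bool" where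
  "min_unsat \<Xi> \<longleftrightarrow> \<not> satisfiable \<Xi> \<and> (\<forall>\<Psi>. \<Psi> \<subset> \<Xi> \<longrightarrow> satisfiable \<Psi>)"

lemma min_unsat_proper: "min_unsat \<Xi> \<Longrightarrow> \<Psi> \<subset> \<Xi> \<Longrightarrow> \<exists>\<sigma>. satisfies \<sigma> \<Psi>"
  unfolding min_unsat_def satisfiable_iff[symmetric] by simp

lemma min_unsat_not_satisfies: "min_unsat \<Xi> \<Longrightarrow> \<not> satisfies \<sigma> \<Xi>"
  unfolding min_unsat_def satisfiable_iff by simp

lemma ex_min_unsat:
  assumes "finite \<Phi>" "\<not> satisfiable \<Phi>"
  shows "\<exists>\<Xi>\<subseteq>\<Phi>. min_unsat \<Xi>"
proof -
  let ?U = "{\<Psi>. \<Psi> \<subseteq> \<Phi> \<and> \<not> satisfiable \<Psi>}"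
  have U: "finite ?U" "?U \<noteq> {}" using assms by auto
  obtain \<Xi> where \<Xi>: "\<Xi> \<in> ?U" "\<forall>\<Psi>\<in>?U. \<Psi> \<subseteq> \<Xi> \<longrightarrow> \<Xi> = \<Psi>"
    by (rule bexE[OF finite_has_minimal[OF U]])
  have "satisfiable \<Psi>" if "\<Psi> \<subset> \<Xi>" for \<Psi>
  proof (rule ccontr)
    assume "\<not> satisfiable \<Psi>"
    then have "\<Psi> \<in> ?U" using that \<Xi>(1) by auto
    then show False using \<Xi>(2) that by auto
  qed
  then have "min_unsat \<Xi>" using \<Xi>(1) by (simp add: min_unsat_def)
  then show ?thesis using \<Xi>(1) by blast
qed

text \<open>Tarsi's lemma.  A subformula of maximal deficiency has, by Hall's theorem, a complement
  that can be satisfied using only fresh variables.\<close>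

lemma min_unsat_card_vars_less:
  assumes fin: "finite \<Xi>" "\<And>C. C \<in> \<Xi> \<Longrightarrow> finite C" and min: "min_unsat \<Xi>"
  shows "card (vars \<Xi>) < card \<Xi>"
proof (rule ccontr)
  assume neg: "\<not> card (vars \<Xi>) < card \<Xi>"
  \<comment> \<open>\<open>d\<close> is the negated deficiency, so maximal deficiency means minimal
    \<open>d\<close>.\<close>
  define d where "d \<Psi> = int (card (vars \<Psi>)) - int (card \<Psi>)" for \<Psi>
  let ?M = "arg_min_on d (Pow \<Xi>)"
  have M: "?M \<in> Pow \<Xi>" "\<And>\<Theta>. \<Theta> \<subseteq> \<Xi> \<Longrightarrow> d ?M \<le> d \<Theta>"
    using arg_min_if_finite[of "Pow \<Xi>" d] fin by (auto simp: not_less)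
  \<comment> \<open>The minimiser must be proper in order to be satisfiable. If it is
    \<open>\<Xi>\<close> itself, the assumption to be refuted gives
    \<open>d {} = 0 \<le> d \<Xi>\<close>, so the empty formula is a minimiser too.\<close>
  obtain \<Psi> where \<Psi>: "\<Psi> \<subset> \<Xi>" and opt: "\<And>\<Theta>. \<Theta> \<subseteq> \<Xi> \<Longrightarrow> d \<Psi> \<le> d \<Theta>"
  proof (cases "?M = \<Xi>")
    case True
    have "{} \<subset> \<Xi>" using min unfolding min_unsat_def satisfiable_def by auto
    moreover have "d {} \<le> d \<Theta>" if "\<Theta> \<subseteq> \<Xi>" for \<Theta>
    proof -
      have "d {} \<le> d \<Xi>" using neg by (simp add: d_def vars_def)
      also have "\<dots> \<le> d \<Theta>" using M(2)[OF that] True by simp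
      finally show ?thesis .
    qed
    ultimately show ?thesis using that by blast
  next
    case False
    then show ?thesis using M(1) by (intro that[OF _ M(2)]) auto
  qed
  have finv: "finite (vars \<Theta>)" if "\<Theta> \<subseteq> \<Xi>" for \<Theta>
    using that fin finite_subset[OF that] unfolding vars_def by blast
  obtain \<tau> where \<tau>: "satisfies \<tau> \<Psi>"
    by (rule exE[OF min_unsat_proper[OF min \<Psi>]])
  \<comment> \<open>Hall's condition for the variables outside \<open>\<Psi>\<close>: a violation by
    \<open>J\<close> would make \<open>d (\<Psi> \<union> J)\<close> smaller than
    \<open>d \<Psi>\<close>.\<close>
  have "card J \<le> card (\<Union>((\<lambda>C. var ` C - vars \<Psi>) ` J))" if J: "J \<subseteq> \<Xi> - \<Psi>" for J
  proof -
    have finJ: "finite J" "finite \<Psi>" using J \<Psi> fin finite_subset by blast+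
    have eq: "vars (\<Psi> \<union> J) = vars \<Psi> \<union> \<Union>((\<lambda>C. var ` C - vars \<Psi>) ` J)"
      by (auto simp: vars_def)
    have "card (vars (\<Psi> \<union> J)) \<le> card (vars \<Psi>) + card (\<Union>((\<lambda>C. var ` C - vars \<Psi>) ` J))"
      unfolding eq by (rule card_Un_le)
    moreover have "card (\<Psi> \<union> J) = card \<Psi> + card J"
      using J finJ by (intro card_Un_disjoint) auto
    moreover have "d \<Psi> \<le> d (\<Psi> \<union> J)" using J \<Psi> by (intro opt) auto
    ultimately show ?thesis by (simp add: d_def)
  qed
  then have "\<exists>f. inj_on f (\<Xi> - \<Psi>) \<and> (\<forall>C\<in>\<Xi> - \<Psi>. f C \<in> var ` C - vars \<Psi>)"
    using fin by (intro hall_matching) auto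
  then obtain f where f: "inj_on f (\<Xi> - \<Psi>)" "\<forall>C\<in>\<Xi> - \<Psi>. f C \<in> var ` C - vars \<Psi>"
    by (elim exE conjE)
  from satisfies_matching[OF f, where \<tau> = \<tau>]
  obtain \<sigma> where \<sigma>: "\<forall>v\<in>vars \<Psi>. \<sigma> v = \<tau> v" "satisfies \<sigma> (\<Xi> - \<Psi>)"
    by (elim exE conjE)
  have "lit_true \<sigma> l = lit_true \<tau> l" if "C \<in> \<Psi>" "l \<in> C" for C l
    using that bspec[OF \<sigma>(1), of "var l"] by (intro lit_true_cong) (auto simp: vars_def)
  then have "satisfies \<sigma> \<Psi>" using \<tau> unfolding satisfies_def by blast
  then have "satisfies \<sigma> \<Xi>" using \<sigma>(2) unfolding satisfies_def by blast
  then show False using min_unsat_not_satisfies[OF min] by simp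
qed

text \<open>If \<open>negate l\<close> never occurred, a model of the clauses without
  \<open>l\<close> could be changed to make \<open>l\<close> true, falsifying no clause and
  satisfying all the others.\<close>

lemma min_unsat_negate_occurs:
  assumes min: "min_unsat \<Xi>" and "C \<in> \<Xi>" "l \<in> C"
  shows "\<exists>D\<in>\<Xi>. negate l \<in> D"
proof (rule ccontr)
  assume neg: "\<not> ?thesis"
  have "{D \<in> \<Xi>. l \<notin> D} \<subset> \<Xi>" using assms by blast
  then obtain \<sigma> where \<sigma>: "satisfies \<sigma> {D \<in> \<Xi>. l \<notin> D}"
    by (rule exE[OF min_unsat_proper[OF min]])
  let ?\<tau> = "\<sigma>(var l := lit_true (\<lambda>_. True) l)"
  have "\<exists>l'\<in>D. lit_true ?\<tau> l'" if D: "D \<in> \<Xi>" for D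
  proof (cases "l \<in> D")
    case True
    then show ?thesis using lit_true_upd[of \<sigma> l] by (rule rev_bexI)
  next
    case False
    then obtain l' where l': "l' \<in> D" "lit_true \<sigma> l'" using \<sigma> D by (auto simp: satisfies_def)
    have "var l' \<noteq> var l" using l' D False neg by (auto simp: var_eq_iff)
    then have "lit_true ?\<tau> l' = lit_true \<sigma> l'" by (intro lit_true_cong) auto
    then show ?thesis using l' by blast
  qed
  then have "satisfies ?\<tau> \<Xi>" by (simp add: satisfies_def)
  then show False using min_unsat_not_satisfies[OF min] by simp
qed

section \<open>The spine and minimally unsatisfiable subformulas\<close>

lemma Spine_mono: "\<Phi> \<subseteq> \<Psi> \<Longrightarrow> Spine \<Phi> \<subseteq> Spine \<Psi>"
  unfolding Spine_def by blast

text \<open>Making a literal \<open>x\<close> false can only hurt clauses that contain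
  \<open>x\<close>. The consequence needed is finiteness of the spine, without which comparing
  values of \<open>card\<close> would be meaningless.\<close>

lemma Spine_subset: "Spine \<Phi> \<subseteq> \<Union>\<Phi>"
proof
  fix x assume "x \<in> Spine \<Phi>"
  then obtain \<Xi> where \<Xi>: "\<Xi> \<subseteq> \<Phi>" "satisfiable \<Xi>" "\<not> satisfiable (insert {negate x} \<Xi>)"
    by (auto simp: Spine_def)
  obtain \<sigma> where \<sigma>: "satisfies \<sigma> \<Xi>" using \<Xi> by (auto simp: satisfiable_iff)
  show "x \<in> \<Union>\<Phi>"
  proof (rule ccontr)
    assume x: "x \<notin> \<Union>\<Phi>"
    let ?\<tau> = "\<sigma>(var (negate x) := lit_true (\<lambda>_. True) (negate x))"
    have "\<exists>l\<in>C. lit_true ?\<tau> l" if C: "C \<in> \<Xi>" for C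
    proof -
      obtain l where l: "l \<in> C" "lit_true \<sigma> l" using \<sigma> C by (auto simp: satisfies_def)
      have "l \<noteq> x" using l C x \<Xi> by blast
      then have "lit_true ?\<tau> l"
        using l lit_true_upd[of \<sigma> "negate x"] lit_true_cong[of ?\<tau> l \<sigma>]
        by (cases "var l = var x") (auto simp: var_eq_iff)
      then show ?thesis using l by blast
    qed
    then have "satisfies ?\<tau> (insert {negate x} \<Xi>)"
      using lit_true_upd[of \<sigma> "negate x"] by (auto simp: satisfies_def)
    then show False using \<Xi> satisfiable_iff by blast
  qed
qed

lemma finite_Spine: "finite \<Phi> \<Longrightarrow> (\<And>C. C \<in> \<Phi> \<Longrightarrow> finite C) \<Longrightarrow> finite (Spine \<Phi>)"
  by (rule finite_subset[OF Spine_subset]) auto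

text \<open>For \<open>l\<close> in a clause \<open>C\<close> the witness is
  \<open>\<Xi> - {C}\<close>: it is satisfiable by minimality, and a model of it with
  \<open>l\<close> true would satisfy \<open>C\<close> as well.\<close>

lemma min_unsat_Spine:
  assumes "min_unsat \<Xi>"
  shows "negate ` \<Union>\<Xi> \<subseteq> Spine \<Xi>"
proof
  fix x assume "x \<in> negate ` \<Union>\<Xi>"
  then obtain l C where l: "x = negate l" "l \<in> C" "C \<in> \<Xi>" by blast
  have sat: "satisfiable (\<Xi> - {C})" using assms l by (auto simp: min_unsat_def)
  moreover have "\<not> satisfiable (insert {l} (\<Xi> - {C}))"
  proof
    assume "satisfiable (insert {l} (\<Xi> - {C}))"
    then obtain \<sigma> where \<sigma>: "satisfies \<sigma> (insert {l} (\<Xi> - {C}))"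
      by (auto simp: satisfiable_iff)
    have "\<exists>l\<in>D. lit_true \<sigma> l" if "D \<in> \<Xi>" for D
      using \<sigma> that l by (cases "D = C") (auto simp: satisfies_def)
    then have "satisfiable \<Xi>" by (auto simp: satisfiable_def)
    then show False using assms by (simp add: min_unsat_def)
  qed
  ultimately show "x \<in> Spine \<Xi>"
    unfolding Spine_def using l by (intro CollectI exI[of _ "\<Xi> - {C}"]) auto
qed

text \<open>This turns a small spine into an unsatisfiable subformula on few variables, the object
  counted by the first moment.\<close>

lemma card_vars_le_card_Spine:
  assumes "min_unsat \<Xi>" "\<Xi> \<subseteq> \<Phi>" "finite \<Phi>" "\<And>C. C \<in> \<Phi> \<Longrightarrow> finite C"
  shows "card (vars \<Xi>) \<le> card (Spine \<Phi>)"
proof -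
  have fin: "finite (Spine \<Phi>)" by (rule finite_Spine) (use assms in auto)
  have sub: "vars \<Xi> \<subseteq> var ` Spine \<Phi>"
  proof
    fix v assume "v \<in> vars \<Xi>"
    then obtain l where "l \<in> \<Union>\<Xi>" "v = var l" by (auto simp: vars_def)
    then have "negate l \<in> Spine \<Phi>" "v = var (negate l)"
      using min_unsat_Spine[OF assms(1)] Spine_mono[OF assms(2)] by auto
    then show "v \<in> var ` Spine \<Phi>" by blast
  qed
  have "card (vars \<Xi>) \<le> card (var ` Spine \<Phi>)" by (rule card_mono) (use fin sub in auto)
  also have "\<dots> \<le> card (Spine \<Phi>)" by (rule card_image_le[OF fin])
  finally show ?thesis .
qed

section \<open>The core of a minimally unsatisfiable formula\<close>

definition lits :: "nat set \<Rightarrow> literal set" where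
  "lits V = var -` V"

lemma lits_eq: "lits V = Pos ` V \<union> Neg ` V"
proof -
  have "l \<in> lits V \<longleftrightarrow> l \<in> Pos ` V \<union> Neg ` V" for l
    by (cases l) (auto simp: lits_def)
  then show ?thesis by blast
qed

lemma finite_lits: "finite V \<Longrightarrow> finite (lits V)"
  by (simp add: lits_eq)

lemma card_lits: "finite V \<Longrightarrow> card (lits V) = 2 * card V"
  unfolding lits_eq by (subst card_Un_disjoint) (auto simp: card_image inj_on_def)

text \<open>Double counting of the pairs \<open>(v, C)\<close> with
  \<open>v \<in> A \<inter> f C\<close>.\<close>

lemma sum_card_incidences:
  assumes "finite T" "finite A"
  shows "(\<Sum>v\<in>A. card {C \<in> T. v \<in> f C}) = (\<Sum>C\<in>T. card (A \<inter> f C))"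
proof -
  have "(\<Sum>v\<in>A. card {C \<in> T. v \<in> f C}) = (\<Sum>v\<in>A. \<Sum>C\<in>{C \<in> T. v \<in> f C}. 1)" by simp
  also have "\<dots> = (\<Sum>C\<in>T. \<Sum>v\<in>{v \<in> A. v \<in> f C}. 1)"
    using assms by (intro sum.swap_restrict)
  also have "\<dots> = (\<Sum>C\<in>T. card (A \<inter> f C))"
    by (intro sum.cong) (auto intro: arg_cong[of _ _ card])
  finally show ?thesis .
qed

text \<open>Both literals of every variable occur, so all degrees are at least 2 and those outside
  the core are exactly 2. The final inequalities come from Tarsi's lemma and from summing degrees.
  With \<open>g = card T2 - card U\<close>, \<open>r = card T3\<close> and \<open>k = card K\<close>
  they say \<open>k + 1 \<le> g + r\<close> and \<open>3 * k \<le> 2 * g + 6 * r\<close>.\<close>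

lemma min_unsat_core:
  assumes fin: "finite \<Xi>" and min: "min_unsat \<Xi>"
    and cl: "\<And>C. C \<in> \<Xi> \<Longrightarrow> inj_on var C \<and> (card C = 2 \<or> card C = 3)"
  defines "T2 \<equiv> {C \<in> \<Xi>. card C = 2}" and "T3 \<equiv> {C \<in> \<Xi>. card C = 3}"
  obtains K U where "K \<inter> U = {}" "K \<union> U = vars \<Xi>"
    and "\<forall>C\<in>T3. C \<subseteq> lits K"
    and "\<forall>C\<in>T2. C \<subseteq> lits K \<union> lits U"
    and "\<forall>l\<in>lits U. card {C \<in> T2. l \<in> C} = 1"
    and "K \<noteq> {}"
    and "card U \<le> card T2"
    and "card U + card K + 1 \<le> card T2 + card T3"
    and "2 * card U + 3 * card K \<le> 2 * card T2 + 6 * card T3"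
proof -
  define deg where "deg v = card {C \<in> \<Xi>. v \<in> var ` C}" for v
  define K where "K = vars T3 \<union> {v \<in> vars \<Xi>. deg v \<ge> 3}"
  define U where "U = vars \<Xi> - K"
  have finC: "finite C" if "C \<in> \<Xi>" for C using cl[OF that] card.infinite by fastforce
  have finT: "finite T2" "finite T3" using fin by (auto simp: T2_def T3_def)
  have finV: "finite (vars \<Xi>)" using fin finC by (auto simp: vars_def)
  have T23: "\<Xi> = T2 \<union> T3" "T2 \<inter> T3 = {}" using cl by (auto simp: T2_def T3_def)
  have KU: "K \<inter> U = {}" "K \<union> U = vars \<Xi>" by (auto simp: U_def K_def vars_def T3_def)
  then have finKU: "finite K" "finite U" using finV by (metis finite_Un)+
  have T3K: "C \<subseteq> lits K" if "C \<in> T3" for C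
    using that by (auto simp: K_def lits_def vars_def)
  have T2KU: "C \<subseteq> lits K \<union> lits U" if "C \<in> T2" for C
  proof -
    have "C \<subseteq> lits (vars \<Xi>)" using that by (auto simp: T2_def lits_def vars_def)
    then show ?thesis using KU by (auto simp: lits_def)
  qed
  have occ: "\<exists>C\<in>\<Xi>. l \<in> C" if l: "l \<in> lits (vars \<Xi>)" for l
  proof -
    obtain C l' where C: "C \<in> \<Xi>" "l' \<in> C" "var l = var l'"
      using l unfolding vars_def lits_def by blast
    then show ?thesis using min_unsat_negate_occurs[OF min C(1,2)] by (auto simp: var_eq_iff)
  qed
  have split: "{C \<in> \<Xi>. var l \<in> var ` C} = {C \<in> \<Xi>. l \<in> C} \<union> {C \<in> \<Xi>. negate l \<in> C}"
    for l
  proof -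
    have "var l \<in> var ` C \<longleftrightarrow> l \<in> C \<or> negate l \<in> C" for C
    proof
      assume "var l \<in> var ` C"
      then obtain l' where "l' \<in> C" "var l' = var l" by fastforce
      then show "l \<in> C \<or> negate l \<in> C" unfolding var_eq_iff by blast
    qed (metis image_eqI var_negate)
    then show ?thesis by blast
  qed
  have deg_split: "deg (var l) = card {C \<in> \<Xi>. l \<in> C} + card {C \<in> \<Xi>. negate l \<in> C}" for l
  proof -
    have "{C \<in> \<Xi>. l \<in> C} \<inter> {C \<in> \<Xi>. negate l \<in> C} = {}"
    proof (rule ccontr)
      assume "\<not> ?thesis"
      then obtain C where "C \<in> \<Xi>" "l \<in> C" "negate l \<in> C" by blast
      then show False using cl inj_onD[of var C l "negate l"] negate_neq[of l] by auto
    qed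
    then show ?thesis
      unfolding deg_def split using fin by (subst card_Un_disjoint) auto
  qed
  have pos: "card {C \<in> \<Xi>. l \<in> C} \<ge> 1" if "l \<in> lits (vars \<Xi>)" for l
  proof -
    have "{C \<in> \<Xi>. l \<in> C} \<noteq> {}" using occ[OF that] by blast
    then show ?thesis using fin by (simp add: Suc_le_eq card_gt_0_iff)
  qed
  have deg2: "deg v \<ge> 2" if "v \<in> vars \<Xi>" for v
    using deg_split[of "Pos v"] pos[of "Pos v"] pos[of "Neg v"] that by (auto simp: lits_def)
  have degU: "deg v = 2" if "v \<in> U" for v
    using that deg2[of v] by (auto simp: U_def K_def)
  have one: "card {C \<in> T2. l \<in> C} = 1" if l: "l \<in> lits U" for l
  proof -
    have V: "var l \<in> vars \<Xi>" using l KU by (auto simp: lits_def)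
    have "{C \<in> T2. l \<in> C} = {C \<in> \<Xi>. l \<in> C}"
      using l T3K KU T23 by (fastforce simp: lits_def)
    moreover have "card {C \<in> \<Xi>. l \<in> C} = 1"
      using deg_split[of l] degU[of "var l"] pos[of l] pos[of "negate l"] l V
      by (auto simp: lits_def)
    ultimately show ?thesis by simp
  qed
  have cv: "card (vars \<Xi> \<inter> var ` C) = card C" if "C \<in> \<Xi>" for C
  proof -
    have "vars \<Xi> \<inter> var ` C = var ` C" using that by (auto simp: vars_def)
    then show ?thesis using cl[OF that] by (simp add: card_image)
  qed
  have "(\<Sum>v\<in>vars \<Xi>. deg v) = (\<Sum>C\<in>\<Xi>. card C)"
    unfolding deg_def using fin finV cv by (subst sum_card_incidences) auto
  also have "\<dots> = (\<Sum>C\<in>T2. card C) + (\<Sum>C\<in>T3. card C)"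
    unfolding T23(1) using finT T23(2) by (intro sum.union_disjoint) auto
  also have "\<dots> = 2 * card T2 + 3 * card T3"
    by (auto simp: T2_def T3_def)
  finally have tot: "(\<Sum>v\<in>vars \<Xi>. deg v) = 2 * card T2 + 3 * card T3" .
  have "(\<Sum>v\<in>vars \<Xi>. deg v) = (\<Sum>v\<in>K. deg v) + (\<Sum>v\<in>U. deg v)"
    unfolding KU(2)[symmetric] using finKU KU(1) by (intro sum.union_disjoint) auto
  then have tot': "(\<Sum>v\<in>K. deg v) + 2 * card U = 2 * card T2 + 3 * card T3"
    using tot degU by simp
  \<comment> \<open>A core variable of degree below 3 has degree 2 and lies in a 3-clause. At most
    \<open>3 * card T3\<close> variables do, which bounds the total shortfall.\<close>
  have "3 * card K = (\<Sum>v\<in>K. 3)" by simp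
  also have "\<dots> \<le> (\<Sum>v\<in>K. deg v + (if v \<in> vars T3 then 1 else 0))"
    using deg2 KU by (intro sum_mono) (fastforce simp: K_def)
  also have "\<dots> = (\<Sum>v\<in>K. deg v) + card (K \<inter> vars T3)"
    using finKU by (simp add: sum.distrib sum.If_cases)
  also have "card (K \<inter> vars T3) \<le> card (vars T3)"
    by (intro card_mono finite_subset[OF _ finV]) (auto simp: vars_def T3_def)
  also have "card (vars T3) \<le> (\<Sum>C\<in>T3. card (var ` C))"
    unfolding vars_def by (rule card_UN_le[OF finT(2)])
  also have "\<dots> = (\<Sum>C\<in>T3. 3)"
    using cl by (intro sum.cong) (auto simp: T3_def card_image)
  finally have k3: "3 * card K \<le> (\<Sum>v\<in>K. deg v) + 3 * card T3" by simp
  \<comment> \<open>A 2-clause holds at most two of the \<open>2 * card U\<close> occurrences of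
    non-core variables, and a 3-clause none.\<close>
  have "2 * card U = (\<Sum>v\<in>U. deg v)" using degU by simp
  also have "\<dots> = (\<Sum>C\<in>\<Xi>. card (U \<inter> var ` C))"
    unfolding deg_def using fin finKU by (intro sum_card_incidences)
  also have "\<dots> \<le> (\<Sum>C\<in>\<Xi>. if C \<in> T2 then 2 else 0)"
  proof (intro sum_mono)
    fix C assume C: "C \<in> \<Xi>"
    have "card (U \<inter> var ` C) \<le> card (vars \<Xi> \<inter> var ` C)"
      using finV KU by (intro card_mono) auto
    moreover have "U \<inter> var ` C = {}" if "C \<in> T3"
      using T3K[OF that] KU by (auto simp: lits_def)
    moreover have "C \<in> T3" if "C \<notin> T2" using that C T23 by blast
    moreover have "card C = 2" if "C \<in> T2" using that by (simp add: T2_def)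
    ultimately show "card (U \<inter> var ` C) \<le> (if C \<in> T2 then 2 else 0)"
      using cv[OF C] by (cases "C \<in> T2") auto
  qed
  also have "\<dots> = 2 * card T2"
    using fin by (simp add: sum.If_cases T2_def Int_def)
  finally have ut: "card U \<le> card T2" by simp
  have cX: "card \<Xi> = card T2 + card T3"
    unfolding T23(1) using finT T23(2) by (intro card_Un_disjoint) auto
  have cVs: "card (vars \<Xi>) = card K + card U"
    unfolding KU(2)[symmetric] using finKU KU(1) by (intro card_Un_disjoint) auto
  have tarsi: "card U + card K + 1 \<le> card T2 + card T3"
    using min_unsat_card_vars_less[OF fin finC min] cX cVs by simp
  \<comment> \<open>An empty core would leave only 2-clauses with all degrees 2, hence as many
    clauses as variables, against Tarsi's lemma.\<close>
  have "K \<noteq> {}"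
  proof
    assume K: "K = {}"
    have "T3 = {}"
    proof (rule ccontr)
      assume "T3 \<noteq> {}"
      then obtain C where "C \<in> T3" by blast
      then have "C \<subseteq> {}" "card C = 3" using T3K K by (auto simp: lits_def T3_def)
      then show False by simp
    qed
    then show False using tot' tarsi K by simp
  qed
  then show ?thesis
    using that[OF KU _ _ _ _ ut tarsi] T3K T2KU one k3 tot' by simp
qed

section \<open>Subsequences of independent samples\<close>

lemma prob_pair_pmf_Times:
  "measure_pmf.prob (pair_pmf p q) (A \<times> B) = measure_pmf.prob p A * measure_pmf.prob q B"
proof -
  have "measure_pmf.prob (pair_pmf p q) (A \<times> B)
      = measure_pmf.prob (pair_pmf p q) ((A \<inter> set_pmf p) \<times> (B \<inter> set_pmf q))"
    by (subst measure_Int_set_pmf[symmetric]) (auto intro: arg_cong[where f = "measure _"])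
  also have "\<dots> = measure_pmf.prob p (A \<inter> set_pmf p) * measure_pmf.prob q (B \<inter> set_pmf q)"
    by (intro measure_pmf_prob_product) auto
  finally show ?thesis by (simp add: measure_Int_set_pmf)
qed

lemma replicate_pmf_Suc_pair:
  "replicate_pmf (Suc m) p = map_pmf (\<lambda>(x, xs). x # xs) (pair_pmf p (replicate_pmf m p))"
  by (simp add: pair_pmf_def map_bind_pmf)

text \<open>A union bound over the positions of \<open>zs\<close>. In the induction the first sample
  is either skipped or equal to the head of \<open>zs\<close>, and the two cases add up by Pascal's
  rule.\<close>

lemma prob_subseq_le:
  "measure_pmf.prob (replicate_pmf m p) {xs. subseq zs xs}
     \<le> real (m choose length zs) * prod_list (map (pmf p) zs)"
proof (induction m arbitrary: zs)
  case 0
  show ?case by (cases zs) auto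
next
  case (Suc m)
  show ?case
  proof (cases zs)
    case Nil
    then show ?thesis by simp
  next
    case (Cons z zs')
    let ?R = "replicate_pmf m p" and ?w = "prod_list (map (pmf p) zs')"
    let ?P = "measure_pmf.prob (pair_pmf p ?R)"
    have "measure_pmf.prob (replicate_pmf (Suc m) p) {xs. subseq zs xs}
        = ?P ((\<lambda>(x, xs). x # xs) -` {xs. subseq zs xs})"
      unfolding replicate_pmf_Suc_pair by simp
    also have "\<dots> \<le> ?P (UNIV \<times> {xs. subseq zs xs} \<union> {z} \<times> {xs. subseq zs' xs})"
      by (intro measure_pmf.finite_measure_mono)
        (auto simp: Cons split: if_splits)
    also have "\<dots> \<le> ?P (UNIV \<times> {xs. subseq zs xs}) + ?P ({z} \<times> {xs. subseq zs' xs})"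
      by (intro measure_Un_le) auto
    also have "\<dots> = measure_pmf.prob ?R {xs. subseq zs xs}
        + pmf p z * measure_pmf.prob ?R {xs. subseq zs' xs}"
      by (simp add: prob_pair_pmf_Times measure_pmf_single)
    also have "\<dots> \<le> real (m choose length zs) * (pmf p z * ?w)
        + pmf p z * (real (m choose length zs') * ?w)"
      using Suc.IH[of zs] Suc.IH[of zs'] Cons
      by (intro add_mono mult_left_mono) auto
    also have "\<dots> = real (Suc m choose length zs) * prod_list (map (pmf p) zs)"
      by (simp add: Cons algebra_simps)
    finally show ?thesis .
  qed
qed

lemma prob_ex_subseq_le:
  assumes A: "finite A" "A \<noteq> {}" and "finite Q"
    and Q: "\<And>zs. zs \<in> Q \<Longrightarrow> length zs = t"
  shows "measure_pmf.prob (replicate_pmf m (pmf_of_set A)) {xs. \<exists>zs\<in>Q. subseq zs xs}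
     \<le> real (m choose t) * real (card Q) / real (card A) ^ t"
proof -
  let ?R = "replicate_pmf m (pmf_of_set A)"
  \<comment> \<open>Only an inequality, because entries of \<open>zs\<close> outside
    \<open>A\<close> have weight 0.\<close>
  have le: "prod_list (map (pmf (pmf_of_set A)) zs) \<le> (1 / real (card A)) ^ length zs" for zs
  proof (induction zs)
    case (Cons z zs)
    have "pmf (pmf_of_set A) z \<le> 1 / real (card A)" using A by (simp add: indicator_def)
    then have "pmf (pmf_of_set A) z * prod_list (map (pmf (pmf_of_set A)) zs)
        \<le> 1 / real (card A) * (1 / real (card A)) ^ length zs"
      using Cons.IH by (intro mult_mono) (auto intro!: prod_list_nonneg)
    then show ?case by simp
  qed simp
  have "measure_pmf.prob ?R {xs. \<exists>zs\<in>Q. subseq zs xs}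
      = measure_pmf.prob ?R (\<Union>zs\<in>Q. {xs. subseq zs xs})"
    by (intro arg_cong[where f = "measure _"]) auto
  also have "\<dots> \<le> (\<Sum>zs\<in>Q. measure_pmf.prob ?R {xs. subseq zs xs})"
    using \<open>finite Q\<close> by (intro measure_UNION_le) auto
  also have "\<dots> \<le> (\<Sum>zs\<in>Q. real (m choose t) * (1 / real (card A)) ^ t)"
  proof (intro sum_mono)
    fix zs assume zs: "zs \<in> Q"
    show "measure_pmf.prob ?R {xs. subseq zs xs} \<le> real (m choose t) * (1 / real (card A)) ^ t"
      using prob_subseq_le[of m "pmf_of_set A" zs] mult_left_mono[OF le[of zs], of "real (m choose t)"]
        Q[OF zs] by simp
  qed
  also have "\<dots> = real (m choose t) * real (card Q) / real (card A) ^ t"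
    by (simp add: power_divide)
  finally show ?thesis .
qed

section \<open>Counting 2-clauses in which the non-core literals occur once\<close>

text \<open>The number of words of length \<open>s\<close> over \<open>a + \<kappa>\<close> letters in which \<open>a\<close> given letters occur
  exactly once.\<close>

definition marked_words :: "nat \<Rightarrow> nat \<Rightarrow> nat \<Rightarrow> nat" where
  "marked_words \<kappa> s a = (s choose a) * fact a * \<kappa> ^ (s - a)"

text \<open>Split by the first letter: one of the \<open>\<kappa>\<close> free letters, or one of
  the \<open>a\<close> marked ones, which is then used up. For \<open>a = 0\<close> the truncated
  \<open>a - 1\<close> is multiplied by 0.\<close>

lemma marked_words_Suc:
  "marked_words \<kappa> (Suc s) a = \<kappa> * marked_words \<kappa> s a + a * marked_words \<kappa> s (a - 1)"
proof (cases a)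
  case (Suc b)
  show ?thesis
  proof (cases "Suc b \<le> s")
    case True
    then have "\<kappa> ^ (s - b) = \<kappa> * \<kappa> ^ (s - Suc b)"
      by (metis Suc_diff_Suc Suc_le_lessD power_Suc)
    then show ?thesis by (simp add: marked_words_def Suc algebra_simps)
  next
    case False
    then show ?thesis by (simp add: marked_words_def Suc binomial_eq_0 not_le algebra_simps)
  qed
qed (simp add: marked_words_def)

text \<open>Applied with \<open>L = lits U\<close> and \<open>M = lits K\<close>. That a clause
  cannot contain complementary literals is forgotten, which only enlarges the count.\<close>

definition pair_lists :: "'a set \<Rightarrow> 'a set \<Rightarrow> nat \<Rightarrow> 'a set list set" where
  "pair_lists L M t = {zs. length zs = t \<and> (\<forall>C\<in>set zs. card C = 2 \<and> C \<subseteq> L \<union> M)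
     \<and> (\<forall>l\<in>L. length (filter (\<lambda>C. l \<in> C) zs) = 1)}"

lemma finite_pair_lists:
  assumes "finite L" "finite M"
  shows "finite (pair_lists L M t)"
proof (rule finite_subset)
  show "pair_lists L M t \<subseteq> {zs. set zs \<subseteq> Pow (L \<union> M) \<and> length zs = t}"
    by (auto simp: pair_lists_def)
  show "finite {zs. set zs \<subseteq> Pow (L \<union> M) \<and> length zs = t}"
    using assms by (intro finite_lists_length_eq) auto
qed

text \<open>The elements of \<open>L\<close> in the first pair are used up and may not return in the
  tail.\<close>

lemma pair_lists_Suc_subset:
  "pair_lists L M (Suc t)
     \<subseteq> (\<Union>C\<in>{C. C \<subseteq> L \<union> M \<and> card C = 2}. (#) C ` pair_lists (L - C) M t)"
proof
  fix zs assume zs: "zs \<in> pair_lists L M (Suc t)"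
  then obtain C ws where zs_eq: "zs = C # ws" by (cases zs) (auto simp: pair_lists_def)
  have C: "C \<subseteq> L \<union> M" "card C = 2" using zs by (auto simp: pair_lists_def zs_eq)
  have disj: "l \<notin> D" if "l \<in> L" "l \<in> C" "D \<in> set ws" for l D
  proof -
    have "length (filter (\<lambda>C. l \<in> C) zs) = 1" using zs that by (auto simp: pair_lists_def)
    then have "filter (\<lambda>C. l \<in> C) ws = []" using that by (simp add: zs_eq)
    then show ?thesis using that by (auto simp: filter_empty_conv)
  qed
  have "ws \<in> pair_lists (L - C) M t"
    using zs disj unfolding pair_lists_def zs_eq by (auto split: if_splits)
  then show "zs \<in> (\<Union>C\<in>{C. C \<subseteq> L \<union> M \<and> card C = 2}. (#) C ` pair_lists (L - C) M t)"
    using C zs_eq by blast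
qed

lemma two_times_choose_two: "2 * (n choose 2) = n * (n - 1)"
proof -
  have "even (n * (n - 1))" by (cases n) auto
  then show ?thesis unfolding choose_two by (rule dvd_mult_div_cancel)
qed

text \<open>The three terms correspond to pairs with two, one or no elements in
  \<open>L\<close>.\<close>

lemma sum_pairs_le:
  fixes N :: "nat \<Rightarrow> nat"
  assumes fin: "finite L" "finite M" and disj: "L \<inter> M = {}"
  shows "(\<Sum>C\<in>{C. C \<subseteq> L \<union> M \<and> card C = 2}. N (card (L - C)))
     \<le> (card L choose 2) * N (card L - 2) + card L * card M * N (card L - 1)
       + (card M choose 2) * N (card L)"
proof -
  let ?A = "{C. C \<subseteq> L \<and> card C = 2}" and ?B = "(\<lambda>(x, y). {x, y}) ` (L \<times> M)"
    and ?D = "{C. C \<subseteq> M \<and> card C = 2}" and ?f = "\<lambda>C. N (card (L - C))"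
  have finABD: "finite ?A" "finite ?B" "finite ?D" using fin by auto
  have Un_le: "sum ?f (X \<union> Y) \<le> sum ?f X + sum ?f Y" if "finite X" "finite Y" for X Y
    using sum.union_inter[OF that, of ?f] by linarith
  have "{C. C \<subseteq> L \<union> M \<and> card C = 2} \<subseteq> ?A \<union> ?B \<union> ?D"
  proof
    fix C assume C: "C \<in> {C. C \<subseteq> L \<union> M \<and> card C = 2}"
    then obtain x y where xy: "C = {x, y}" "x \<noteq> y" by (auto simp: card_2_iff)
    show "C \<in> ?A \<union> ?B \<union> ?D"
      using C xy by (cases "x \<in> L"; cases "y \<in> L") (auto simp: insert_commute)
  qed
  then have "sum ?f {C. C \<subseteq> L \<union> M \<and> card C = 2} \<le> sum ?f (?A \<union> ?B \<union> ?D)"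
    using finABD by (intro sum_mono2) auto
  also have "\<dots> \<le> sum ?f (?A \<union> ?B) + sum ?f ?D" using finABD by (intro Un_le) auto
  also have "sum ?f (?A \<union> ?B) \<le> sum ?f ?A + sum ?f ?B" using finABD by (intro Un_le) auto
  also have "sum ?f ?A = (\<Sum>C\<in>?A. N (card L - 2))"
    by (intro sum.cong refl) (auto simp: card_Diff_subset finite_subset[OF _ fin(1)])
  also have "\<dots> = (card L choose 2) * N (card L - 2)"
    using n_subsets[OF fin(1)] by simp
  also have "sum ?f ?B \<le> sum (?f \<circ> (\<lambda>(x, y). {x, y})) (L \<times> M)"
    using fin by (intro sum_image_le) auto
  also have "\<dots> = (\<Sum>p\<in>L \<times> M. N (card L - 1))"
  proof (intro sum.cong refl)
    fix p assume p: "p \<in> L \<times> M"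
    obtain x y where xy: "p = (x, y)" by (cases p)
    have "L - {x, y} = L - {x}" using disj p xy by auto
    then show "(?f \<circ> (\<lambda>(x, y). {x, y})) p = N (card L - 1)" using p xy fin by simp
  qed
  also have "\<dots> = card L * card M * N (card L - 1)" by (simp add: card_cartesian_product)
  also have "sum ?f ?D = (\<Sum>C\<in>?D. N (card L))"
    using disj by (intro sum.cong refl arg_cong[where f = N] arg_cong[where f = card]) auto
  also have "\<dots> = (card M choose 2) * N (card L)"
    using n_subsets[OF fin(2)] by simp
  finally show ?thesis by simp
qed

text \<open>Listing the two elements of every pair in either order turns one such list into
  \<open>2 ^ t\<close> words of length \<open>2 * t\<close>.\<close>

lemma card_pair_lists_le:
  assumes "finite L" "finite M" "L \<inter> M = {}"
  shows "card (pair_lists L M t) * 2 ^ t \<le> marked_words (card M) (2 * t) (card L)"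
  using assms(1,3)
proof (induction t arbitrary: L)
  case 0
  show ?case
  proof (cases "L = {}")
    case True
    then have "pair_lists L M 0 = {[]}" by (auto simp: pair_lists_def)
    then show ?thesis using True by (simp add: marked_words_def)
  next
    case False
    then have "pair_lists L M 0 = {}" by (auto simp: pair_lists_def)
    then show ?thesis by simp
  qed
next
  case (Suc t)
  let ?X = "{C. C \<subseteq> L \<union> M \<and> card C = 2}" and ?a = "card L" and ?k = "card M"
  let ?N = "marked_words ?k (2 * t)"
  have finX: "finite ?X" using Suc.prems assms by simp
  have finP: "finite (pair_lists (L - C) M t)" for C
    using Suc.prems assms by (intro finite_pair_lists) auto
  have "card (pair_lists L M (Suc t))
      \<le> card (\<Union>C\<in>?X. (#) C ` pair_lists (L - C) M t)"
    using finX finP by (intro card_mono pair_lists_Suc_subset) auto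
  also have "\<dots> \<le> (\<Sum>C\<in>?X. card ((#) C ` pair_lists (L - C) M t))"
    by (rule card_UN_le[OF finX])
  also have "\<dots> \<le> (\<Sum>C\<in>?X. card (pair_lists (L - C) M t))"
    by (intro sum_mono card_image_le finP)
  finally have "card (pair_lists L M (Suc t)) * 2 ^ t
      \<le> (\<Sum>C\<in>?X. card (pair_lists (L - C) M t) * 2 ^ t)"
    by (simp add: sum_distrib_right[symmetric])
  also have "\<dots> \<le> (\<Sum>C\<in>?X. ?N (card (L - C)))"
    using Suc.prems by (intro sum_mono Suc.IH) auto
  also have "\<dots> \<le> (?a choose 2) * ?N (?a - 2) + ?a * ?k * ?N (?a - 1) + (?k choose 2) * ?N ?a"
    using Suc.prems assms by (intro sum_pairs_le) auto
  finally have "card (pair_lists L M (Suc t)) * 2 ^ Suc t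
      \<le> 2 * ((?a choose 2) * ?N (?a - 2) + ?a * ?k * ?N (?a - 1) + (?k choose 2) * ?N ?a)"
    by simp
  also have "\<dots> = 2 * (?a choose 2) * ?N (?a - 2) + 2 * ?a * ?k * ?N (?a - 1)
      + 2 * (?k choose 2) * ?N ?a"
    by (simp add: algebra_simps)
  also have "2 * (?a choose 2) = ?a * (?a - 1)" by (rule two_times_choose_two)
  also have "2 * (?k choose 2) = ?k * (?k - 1)" by (rule two_times_choose_two)
  \<comment> \<open>Also allowing the same letter of \<open>M\<close> twice in a pair completes the
    expression to two steps of \<open>marked_words_Suc\<close>.\<close>
  also have "?a * (?a - 1) * ?N (?a - 2) + 2 * ?a * ?k * ?N (?a - 1) + ?k * (?k - 1) * ?N ?a
      \<le> ?a * (?a - 1) * ?N (?a - 2) + 2 * ?a * ?k * ?N (?a - 1) + ?k * ?k * ?N ?a"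
    by simp
  also have "\<dots> = marked_words ?k (2 * Suc t) ?a"
    by (simp add: marked_words_Suc algebra_simps numeral_2_eq_2)
  finally show ?case .
qed

section \<open>The number of clauses\<close>

lemma finite_clauses: "finite (clauses n k)"
proof (rule finite_subset)
  show "clauses n k \<subseteq> Pow (lits {..<n})" by (auto simp: clauses_def lits_def)
  show "finite (Pow (lits {..<n}))" by (simp add: finite_lits)
qed

lemma finite_clause: "C \<in> clauses n k \<Longrightarrow> finite C"
  by (rule finite_subset[of _ "lits {..<n}"]) (auto simp: clauses_def lits_def finite_lits[unfolded lits_def])

text \<open>A clause is determined by its variable set \<open>S\<close> and the subset
  \<open>T\<close> of variables occurring positively. A lower bound suffices because these numbers
  only enter as denominators.\<close>

lemma card_clauses_ge: "(n choose k) * 2 ^ k \<le> card (clauses n k)"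
proof -
  let ?S = "{S. S \<subseteq> {..<n} \<and> card S = k}"
  let ?g = "\<lambda>(S, T). Pos ` T \<union> Neg ` (S - T)"
  have "card (Sigma ?S Pow) = (\<Sum>S\<in>?S. card (Pow S))"
    by (intro card_SigmaI) (auto intro: finite_subset)
  also have "\<dots> = (\<Sum>S\<in>?S. 2 ^ k)"
    by (intro sum.cong) (auto simp: card_Pow finite_subset)
  also have "\<dots> = (n choose k) * 2 ^ k" using n_subsets[of "{..<n}" k] by simp
  finally have "(n choose k) * 2 ^ k = card (Sigma ?S Pow)" ..
  also have "\<dots> \<le> card (clauses n k)"
  proof (rule card_inj_on_le[OF _ _ finite_clauses])
    show "inj_on ?g (Sigma ?S Pow)"
      by (rule inj_on_inverseI[where g = "\<lambda>C. (var ` C, {v. Pos v \<in> C})"])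
        (auto simp: image_Un image_image)
    show "?g ` Sigma ?S Pow \<subseteq> clauses n k"
    proof clarify
      fix S T assume ST: "S \<subseteq> {..<n}" "k = card S" "T \<subseteq> S"
      have fin: "finite S" "finite T" using ST by (auto intro: finite_subset)
      have "card (Pos ` T \<union> Neg ` (S - T)) = card T + card (S - T)"
        using fin by (subst card_Un_disjoint) (auto simp: card_image inj_on_def)
      also have "\<dots> = card S" using fin ST by (simp add: card_Diff_subset card_mono)
      finally show "Pos ` T \<union> Neg ` (S - T) \<in> clauses n (card S)"
        using ST by (auto simp: clauses_def inj_on_def)
    qed
  qed
  finally show ?thesis .
qed

section \<open>Estimating the first moment\<close>

text \<open>A single term of the exponential series.\<close>

lemma power_le_exp_fact: "0 \<le> x \<Longrightarrow> x ^ n / fact n \<le> exp (x::real)"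
proof -
  assume x: "0 \<le> x"
  have "x ^ n / fact n = (\<Sum>k\<in>{n}. x ^ k /\<^sub>R fact k)" by (simp add: field_simps)
  also have "\<dots> \<le> (\<Sum>k. x ^ k /\<^sub>R fact k)"
    using x by (intro sum_le_suminf summable_exp_generic) auto
  finally show ?thesis by (simp add: exp_def)
qed

lemma binomial_le_power_fact: "real (n choose k) \<le> real n ^ k / fact k"
proof -
  have "real ((n choose k) * fact k) \<le> real (n ^ k)"
    using binomial_fact_pow[of n k] by (subst of_nat_le_iff) simp
  then show ?thesis by (simp add: field_simps)
qed

lemma geometric_sum_le:
  fixes x :: real
  assumes "0 \<le> x" "x < 1"
  shows "(\<Sum>k\<le>n. x ^ k) \<le> 1 / (1 - x)"
  using assms by (simp add: sum_gp0 divide_right_mono)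

text \<open>For \<open>n \<ge> 4\<close> one has \<open>(n - 1) * (n - 2) \<ge> n ^ 2 / 4\<close>.
  The lost constant factor per 3-clause is harmless.\<close>

lemma three_choose_ge:
  assumes "n \<ge> 4"
  shows "real n ^ 3 / 24 \<le> real (n choose 3)"
proof -
  have "real (n choose 3) = (\<Prod>i = 0..<3. real n - real i) / fact 3"
    using binomial_gbinomial[of n 3, where ?'a = real] by (simp add: gbinomial_prod_rev)
  also have "\<dots> = real n * (real n - 1) * (real n - 2) / 6"
    by (simp add: eval_nat_numeral fact_numeral)
  finally have eq: "real (n choose 3) = real n * ((real n - 1) * (real n - 2)) / 6" by simp
  have "0 \<le> (real n - 4) * (3 * real n)" using assms by (intro mult_nonneg_nonneg) auto
  then have "real n ^ 2 / 4 \<le> (real n - 1) * (real n - 2)"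
    by (simp add: algebra_simps power2_eq_square)
  then have "real n * (real n ^ 2 / 4) \<le> real n * ((real n - 1) * (real n - 2))"
    by (rule mult_left_mono) simp
  then show ?thesis unfolding eq by (simp add: power3_eq_cube power2_eq_square)
qed

section \<open>The expected number of cores with a given profile\<close>

text \<open>The factors count the choices of \<open>K\<close> and \<open>U\<close>, the
  \<open>r\<close> 3-clauses inside \<open>K\<close>, and the \<open>u + g\<close> 2-clauses. The
  last use \<open>marked_words (2 * k) (2 * (u + g)) (2 * u)\<close>, divided by
  \<open>2 ^ (u + g)\<close> for the order within pairs. The denominators bound the numbers of
  clauses from below.\<close>

definition profile_bound :: "nat \<Rightarrow> nat \<Rightarrow> nat \<Rightarrow> nat \<Rightarrow> nat \<Rightarrow> nat \<Rightarrow> nat \<Rightarrow> real" where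
  "profile_bound n m3 m2 k u r g =
     real (n choose k) * real (n choose u)
     * (real (m3 choose r) * real (2 * k choose 3) ^ r / (8 * real (n choose 3)) ^ r)
     * (real (m2 choose (u + g)) * (fact (2 * (u + g)) / fact (2 * g) * (2 * real k) ^ (2 * g) / 2 ^ (u + g))
         / (4 * real (n choose 2)) ^ (u + g))"

text \<open>A random 3-clause falls into the core with probability of order
  \<open>(k / n) ^ 3\<close>, and there are at most \<open>A * n\<close> of them.\<close>

lemma triple_part_le:
  assumes n: "n \<ge> 4" and m3: "real m3 \<le> A * real n"
  shows "real (m3 choose r) * real (2 * k choose 3) ^ r / (8 * real (n choose 3)) ^ r
    \<le> (4 * A * real k ^ 3 / real n ^ 2) ^ r / fact r"
proof -
  have c3: "real (2 * k choose 3) \<le> 8 * real k ^ 3 / 6"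
    using binomial_le_power_fact[of "2 * k" 3] by (simp add: fact_numeral power_mult_distrib)
  have pos: "0 < real n ^ 3 / 24" using n by simp
  have "real (m3 choose r) * real (2 * k choose 3) ^ r / (8 * real (n choose 3)) ^ r
      \<le> (real m3 ^ r / fact r) * (8 * real k ^ 3 / 6) ^ r / (8 * (real n ^ 3 / 24)) ^ r"
    using binomial_le_power_fact[of m3 r] c3 three_choose_ge[OF n] pos
    by (intro frac_le mult_mono power_mono) auto
  also have "\<dots> = (real m3 * (8 * real k ^ 3 / 6) / (8 * (real n ^ 3 / 24))) ^ r / fact r"
    by (simp add: power_mult_distrib power_divide ac_simps)
  also have "real m3 * (8 * real k ^ 3 / 6) / (8 * (real n ^ 3 / 24))
      = real m3 * (4 * real k ^ 3 / real n ^ 3)"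
    by (simp add: field_simps)
  also have "(real m3 * (4 * real k ^ 3 / real n ^ 3)) ^ r / fact r
      \<le> (A * real n * (4 * real k ^ 3 / real n ^ 3)) ^ r / fact r"
    using m3 by (intro divide_right_mono power_mono mult_right_mono) auto
  also have "A * real n * (4 * real k ^ 3 / real n ^ 3) = 4 * A * real k ^ 3 / real n ^ 2"
    using n by (simp add: field_simps eval_nat_numeral)
  finally show ?thesis .
qed

text \<open>One term of the expansion of \<open>(x + y) ^ (u + g)\<close>. It trades the binomial
  coefficient for a factor \<open>1 / y\<close> per segment and a slightly larger ratio in
  \<open>u\<close>.\<close>

lemma binomial_weight_le:
  fixes x y :: real
  assumes "0 \<le> x" "0 < y"
  shows "real (u + g choose g) * x ^ u \<le> (x + y) ^ (u + g) / y ^ g"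
proof -
  have "real (u + g choose g) * y ^ g * x ^ (u + g - g)
      \<le> (\<Sum>i\<le>u + g. real (u + g choose i) * y ^ i * x ^ (u + g - i))"
    using assms by (intro member_le_sum[where f = "\<lambda>i. real (u + g choose i) * y ^ i * x ^ (u + g - i)"]) auto
  also have "\<dots> = (y + x) ^ (u + g)" by (simp add: binomial_ring)
  finally show ?thesis using assms by (simp add: field_simps add.commute)
qed

text \<open>Here subcriticality enters: the slack \<open>(1 - \<beta>) / 2\<close> is spent on the
  binomial coefficient, which leaves a geometric factor in \<open>u\<close>. The remaining
  \<open>fact u / n ^ u\<close> will cancel against the choices of \<open>U\<close>.\<close>

lemma pair_part_le:
  assumes n: "n \<ge> 2" and \<beta>: "0 < \<beta>" "\<beta> < 1" and m2: "real m2 \<le> \<beta> * (real n - 1)"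
  shows "real (m2 choose (u + g)) * (fact (2 * (u + g)) / fact (2 * g) * (2 * real k) ^ (2 * g) / 2 ^ (u + g))
         / (4 * real (n choose 2)) ^ (u + g)
    \<le> ((1 + \<beta>) / 2) ^ u * fact u / real n ^ u * ((8 * real k ^ 2 / ((1 - \<beta>) * real n)) ^ g / fact g)"
    (is "?lhs \<le> _")
proof -
  let ?t = "u + g" and ?\<gamma> = "(1 - \<beta>) / 2"
  define a where "a = real n * (real n - 1)"
  have c2: "4 * real (n choose 2) = 2 * a"
  proof -
    have "real (2 * (n choose 2)) = real (n * (n - 1))" by (simp only: two_times_choose_two)
    then show ?thesis using n by (simp add: a_def of_nat_diff)
  qed
  have npos: "0 < a" using n by (simp add: a_def)
  \<comment> \<open>No exponential factor in \<open>u\<close> may be lost. The \<open>4 ^ ?t\<close>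
    cancels exactly against \<open>2 ^ ?t\<close> for the order in pairs and the 2 in
    \<open>2 * a\<close>.\<close>
  have f2t: "fact (2 * ?t) \<le> (4 ^ ?t * (fact ?t * fact ?t) :: real)"
  proof -
    have "(fact (2 * ?t) :: real) = fact ?t * fact ?t * real (2 * ?t choose ?t)"
      using binomial_fact_lemma[of ?t "2 * ?t"]
      by (metis (no_types, lifting) diff_add_inverse2 le_add1 mult_2 of_nat_fact of_nat_mult)
    also have "\<dots> \<le> fact ?t * fact ?t * 4 ^ ?t"
    proof -
      have "real (2 * ?t choose ?t) \<le> real (2 ^ (2 * ?t))"
        using binomial_le_pow2[of "2 * ?t" ?t] by (subst of_nat_le_iff)
      also have "\<dots> = 4 ^ ?t" unfolding of_nat_power power_mult by simp
      finally show ?thesis by (intro mult_left_mono) auto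
    qed
    finally show ?thesis by (simp add: mult.commute)
  qed
  have f2g: "fact g * fact g \<le> (fact (2 * g) :: real)"
  proof -
    have "fact g * fact g dvd (fact (g + g) :: nat)" by (rule fact_fact_dvd_fact)
    then have "fact g * fact g \<le> (fact (g + g) :: nat)" by (rule dvd_imp_le) simp
    then have "real (fact g * fact g) \<le> real (fact (g + g))" by (subst of_nat_le_iff)
    then show ?thesis by (simp add: mult_2)
  qed
  have "?lhs \<le> (real m2 ^ ?t / fact ?t)
      * ((4 ^ ?t * (fact ?t * fact ?t)) / (fact g * fact g) * (2 * real k) ^ (2 * g) / 2 ^ ?t)
      / (2 * a) ^ ?t"
    unfolding c2 using binomial_le_power_fact[of m2 ?t] f2t f2g npos n
    by (intro divide_right_mono mult_mono frac_le mult_nonneg_nonneg zero_le_power) auto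
  also have "\<dots> = (real m2 / a) ^ ?t * (fact ?t / (fact g * fact g))
      * (2 * real k) ^ (2 * g)"
  proof -
    have "(4::real) ^ ?t = 2 ^ ?t * 2 ^ ?t" by (simp flip: power_mult_distrib)
    then show ?thesis
      by (simp add: power_divide power_mult_distrib, simp add: ac_simps)
  qed
  also have "\<dots> \<le> (\<beta> / real n) ^ ?t * (fact ?t / (fact g * fact g)) * (2 * real k) ^ (2 * g)"
  proof -
    have "real m2 / a \<le> \<beta> * (real n - 1) / a"
      using m2 npos by (intro divide_right_mono) auto
    also have "\<dots> = \<beta> / real n" using n by (simp add: a_def)
    finally show ?thesis using npos by (intro mult_right_mono power_mono) auto
  qed
  \<comment> \<open>The binomial coefficient counts how the \<open>u\<close> chain variables are
    distributed over the segments, up to factors handled elsewhere.\<close>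
  also have "(fact ?t / (fact g * fact g) :: real) = real (u + g choose g) * fact u / fact g"
    using binomial_fact[of g "u + g", where ?'a = real] by (simp add: field_simps)
  also have "(\<beta> / real n) ^ ?t * (real (u + g choose g) * fact u / fact g) * (2 * real k) ^ (2 * g)
      = (real (u + g choose g) * \<beta> ^ u) * \<beta> ^ g * (fact u / real n ^ u)
        * ((4 * real k ^ 2 / real n) ^ g / fact g)"
  proof -
    have "(2 * real k) ^ (2 * g) = (4 * real k ^ 2) ^ g"
      by (simp add: power_mult power_mult_distrib)
    then show ?thesis by (simp add: power_divide power_add, simp add: ac_simps)
  qed
  also have "\<dots> \<le> (((1 + \<beta>) / 2) ^ u / ?\<gamma> ^ g) * 1 * (fact u / real n ^ u)
        * ((4 * real k ^ 2 / real n) ^ g / fact g)"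
  proof (intro mult_right_mono mult_mono)
    have "real (u + g choose g) * \<beta> ^ u \<le> (\<beta> + ?\<gamma>) ^ (u + g) / ?\<gamma> ^ g"
      using \<beta> by (intro binomial_weight_le) auto
    also have "\<beta> + ?\<gamma> = (1 + \<beta>) / 2" by (simp add: field_simps)
    also have "((1 + \<beta>) / 2) ^ (u + g) \<le> ((1 + \<beta>) / 2) ^ u"
      using \<beta> by (intro power_decreasing) auto
    finally show "real (u + g choose g) * \<beta> ^ u \<le> ((1 + \<beta>) / 2) ^ u / ?\<gamma> ^ g"
      using \<beta> by (simp add: divide_right_mono)
    show "\<beta> ^ g \<le> 1" using \<beta> by (intro power_le_one) auto
  qed (use \<beta> in auto)
  also have "\<dots> = ((1 + \<beta>) / 2) ^ u * fact u / real n ^ u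
      * ((8 * real k ^ 2 / ((1 - \<beta>) * real n)) ^ g / fact g)"
  proof -
    have eq: "(4 * real k ^ 2 / real n) ^ g / ?\<gamma> ^ g = (8 * real k ^ 2 / ((1 - \<beta>) * real n)) ^ g"
      unfolding power_divide[symmetric] using \<beta> by (simp add: field_simps)
    show ?thesis
      unfolding eq[symmetric]
      by (simp only: times_divide_eq_left times_divide_eq_right divide_divide_eq_left mult_1_right ac_simps)
  qed
  finally show ?thesis .
qed

text \<open>The exponents of \<open>k / n\<close> collect to \<open>g + 2 * r - k\<close>, and this number dominates
  \<open>k\<close>, \<open>g\<close> and \<open>r\<close> up to a constant factor.\<close>

lemma profile_bound_le:
  assumes n: "n \<ge> 4" and m3: "real m3 \<le> A * real n" and A: "0 \<le> A"
    and \<beta>: "0 < \<beta>" "\<beta> < 1" and m2: "real m2 \<le> \<beta> * (real n - 1)"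
    and k: "1 \<le> k" and gr: "k + 1 \<le> g + r" and dk: "3 * k \<le> 2 * g + 6 * r"
  defines "M \<equiv> exp 12 * (1 + 4 * A) * (8 / (1 - \<beta>)) ^ 3"
  assumes small: "M * real k / real n \<le> 1 / 512"
  shows "profile_bound n m3 m2 k u r g
    \<le> 2048 * M / real n * (((1 + \<beta>) / 2) ^ u * (1 / 2) ^ k * (1 / 2) ^ r * (1 / 2) ^ g)"
proof -
  define q where "q = g + 2 * r - k"
  define \<Gamma> where "\<Gamma> = 8 / (1 - \<beta>)"
  have q: "k \<le> 4 * q" "g \<le> 3 * q" "r \<le> q" "1 \<le> q" "k + q = g + 2 * r"
    \<comment> \<open>The bound on \<open>k\<close> is twice \<open>gr\<close> plus
      \<open>dk\<close>, the one on \<open>g\<close> is \<open>dk\<close>, and the next two follow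
      from \<open>gr\<close>, which also rules out truncation in \<open>q\<close>.\<close>
    using gr dk by (auto simp: q_def)
  have kr: "0 < real k" and nr: "0 < real n" using k n by auto
  have \<Gamma>: "1 \<le> \<Gamma>" using \<beta> by (simp add: \<Gamma>_def field_simps)
  have M0: "0 < M" using A \<beta> by (simp add: M_def)
  let ?\<delta> = "(1 + \<beta>) / 2" and ?x = "real k / real n"
  have \<delta>: "0 \<le> ?\<delta>" using \<beta> by simp
  have nu: "real (n choose u) \<le> real n ^ u / fact u" by (rule binomial_le_power_fact)
  have "profile_bound n m3 m2 k u r g \<le> (real n ^ k / fact k) * (real n ^ u / fact u)
     * ((4 * A * real k ^ 3 / real n ^ 2) ^ r / fact r)
     * (?\<delta> ^ u * fact u / real n ^ u * ((8 * real k ^ 2 / ((1 - \<beta>) * real n)) ^ g / fact g))"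
    unfolding profile_bound_def
    using binomial_le_power_fact[of n k] nu triple_part_le[OF n m3, of r k]
      pair_part_le[OF _ \<beta> m2, of u g k] n A \<beta>
    by (intro mult_mono) (auto intro!: mult_nonneg_nonneg divide_nonneg_nonneg)
  also have "\<dots> = ?\<delta> ^ u * ((real n ^ k / fact k)
     * ((4 * A * real k ^ 3 / real n ^ 2) ^ r / fact r) * ((\<Gamma> * real k ^ 2 / real n) ^ g / fact g))"
    using nr by (simp add: \<Gamma>_def field_simps)
  also have "(real n ^ k / fact k)
     * ((4 * A * real k ^ 3 / real n ^ 2) ^ r / fact r) * ((\<Gamma> * real k ^ 2 / real n) ^ g / fact g)
     = ?x ^ q * (real k ^ k / fact k) * (real k ^ r / fact r) * (real k ^ g / fact g)
       * (4 * A) ^ r * \<Gamma> ^ g"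
  proof -
    have kk: "real k ^ q * real k ^ k = real k ^ g * (real k ^ 2) ^ r"
      using q(5) by (metis add.commute power_add power_mult)
    have nn: "real n ^ q * real n ^ k = real n ^ g * (real n ^ 2) ^ r"
      using q(5) by (metis add.commute power_add power_mult)
    have "?x ^ q * real k ^ k = real n ^ k * ((real k ^ g * (real k ^ 2) ^ r) / (real n ^ g * (real n ^ 2) ^ r))"
      unfolding kk[symmetric] nn[symmetric] using nr by (simp add: power_divide)
    moreover have "(real k ^ 3) ^ r = real k ^ r * (real k ^ 2) ^ r"
      by (simp add: power_mult_distrib[symmetric] eval_nat_numeral)
    moreover have "(real k ^ 2) ^ g = real k ^ g * real k ^ g"
      by (simp add: power_mult_distrib[symmetric] power2_eq_square)
    ultimately show ?thesis
      by (simp add: power_divide power_mult_distrib, simp add: ac_simps)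
  qed
  \<comment> \<open>Each quotient of a power of \<open>k\<close> by a factorial is at most
    \<open>exp k\<close>. The constants are raised to multiples of \<open>q\<close> by
    \<open>r \<le> q\<close> and \<open>g \<le> 3 * q\<close>.\<close>
  also have "\<dots> \<le> ?x ^ q * exp (real k) * exp (real k) * exp (real k) * (1 + 4 * A) ^ q * \<Gamma> ^ (3 * q)"
  proof -
    have "(4 * A) ^ r \<le> (1 + 4 * A) ^ r" using A by (intro power_mono) auto
    also have "\<dots> \<le> (1 + 4 * A) ^ q" using A q by (intro power_increasing) auto
    finally have "(4 * A) ^ r \<le> (1 + 4 * A) ^ q" .
    moreover have "\<Gamma> ^ g \<le> \<Gamma> ^ (3 * q)" using \<Gamma> q by (intro power_increasing) auto
    ultimately show ?thesis
      using A \<Gamma> by (intro mult_mono power_le_exp_fact) (auto intro!: mult_nonneg_nonneg)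
  qed
  \<comment> \<open>The \<open>exp 12\<close> in \<open>M\<close> comes from
    \<open>3 * k \<le> 12 * q\<close>.\<close>
  also have "\<dots> \<le> ?x ^ q * exp 12 ^ q * (1 + 4 * A) ^ q * \<Gamma> ^ (3 * q)"
  proof -
    have "exp (real k) * exp (real k) * exp (real k) = exp (3 * real k)"
      by (simp add: exp_add[symmetric])
    also have "\<dots> \<le> exp (real q * 12)" using q(1) by simp
    also have "\<dots> = exp 12 ^ q" by (rule exp_of_nat_mult)
    finally have "exp (real k) * exp (real k) * exp (real k) \<le> exp 12 ^ q" .
    then have "?x ^ q * (exp (real k) * exp (real k) * exp (real k)) \<le> ?x ^ q * exp 12 ^ q"
      by (intro mult_left_mono) auto
    then show ?thesis using A \<Gamma> by (intro mult_right_mono) (auto simp: mult.assoc)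
  qed
  also have "\<dots> = (M * ?x) ^ q"
    unfolding M_def \<Gamma>_def power_mult_distrib power_mult by (simp only: ac_simps)
  \<comment> \<open>One factor \<open>M * k / n\<close> is kept to supply \<open>1 / n\<close>, with
    \<open>k \<le> 4 * q\<close>. The others are at most \<open>1 / 512 = 2 ^ (-9)\<close>: per unit
    of \<open>q\<close>, one half absorbs the factor \<open>q\<close> and eight pay for
    \<open>k + r + g \<le> 8 * q\<close>. Also \<open>2048 = 4 * 512\<close>.\<close>
  also have "\<dots> \<le> 2048 * M / real n * ((1 / 2) ^ k * (1 / 2) ^ r * (1 / 2) ^ g)"
  proof -
    have y0: "0 \<le> M * ?x" using M0 by simp
    obtain p where p: "q = Suc p" using q(4) by (cases q) auto
    have "(M * ?x) ^ q = M * ?x * (M * ?x) ^ p" by (simp add: p)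
    also have "\<dots> \<le> (M * (4 * real q) / real n) * (1 / 512) ^ p"
      using small M0 nr y0 q(1)
      by (intro mult_mono power_mono) (auto simp: divide_right_mono)
    also have "\<dots> = 2048 * M / real n * (real q * (1 / 2) ^ q * ((1 / 2) ^ (8 * q)))"
    proof -
      have "(1 / 2 :: real) ^ q * (1 / 2) ^ (8 * q) = (1 / 512) ^ q"
        by (simp add: power_mult power_mult_distrib[symmetric] power_one_over)
      also have "\<dots> = (1 / 512) ^ p / 512" by (simp add: p)
      finally show ?thesis by (simp add: mult.assoc)
    qed
    also have "\<dots> \<le> 2048 * M / real n * (1 * (1 / 2) ^ (k + r + g))"
    proof (intro mult_left_mono mult_mono)
      have "real q \<le> 2 ^ q" using of_nat_le_iff[of q "2 ^ q", where ?'a = real] less_exp[of q] by simp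
      then show "real q * (1 / 2) ^ q \<le> 1" by (simp add: power_divide)
      show "(1 / 2 :: real) ^ (8 * q) \<le> (1 / 2) ^ (k + r + g)"
        using q by (intro power_decreasing) auto
    qed (use M0 in auto)
    finally show ?thesis by (simp add: power_add)
  qed
  finally show ?thesis using \<delta> by (simp add: mult_left_mono mult.assoc mult.left_commute)
qed

text \<open>The sum is a product of four geometric sums, three of them at most 2.\<close>

lemma sum_profiles_le:
  fixes \<delta> :: real
  assumes "0 \<le> \<delta>" "\<delta> < 1"
  shows "(\<Sum>(k, u, r, g)\<in>{..N} \<times> {..N} \<times> {..N} \<times> {..N}. \<delta> ^ u * (1 / 2) ^ k * (1 / 2) ^ r * (1 / 2) ^ g)
    \<le> 8 / (1 - \<delta>)"
proof -
  let ?H = "\<Sum>k\<le>N. (1 / 2 :: real) ^ k" and ?D = "\<Sum>u\<le>N. \<delta> ^ u"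
  have "(\<Sum>(k, u, r, g)\<in>{..N} \<times> {..N} \<times> {..N} \<times> {..N}. \<delta> ^ u * (1 / 2) ^ k * (1 / 2) ^ r * (1 / 2) ^ g)
    = (\<Sum>k\<le>N. \<Sum>u\<le>N. \<Sum>r\<le>N. \<Sum>g\<le>N. \<delta> ^ u * (1 / 2) ^ k * (1 / 2) ^ r * (1 / 2) ^ g)"
    by (simp add: sum.cartesian_product)
  also have "\<dots> = ?D * ?H * ?H * ?H"
    by (simp add: sum_distrib_left[symmetric] sum_distrib_right[symmetric] mult.assoc mult.commute)
  also have "\<dots> \<le> 1 / (1 - \<delta>) * 2 * 2 * 2"
    using geometric_sum_le[OF assms, of N] geometric_sum_le[of "1 / 2" N] assms
    by (intro mult_mono) (auto intro!: mult_nonneg_nonneg sum_nonneg)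
  finally show ?thesis by simp
qed

section \<open>Random instances\<close>

text \<open>The instance before concatenation, so that the independent samples of 3-clauses and
  2-clauses stay separate.\<close>

definition instance_pmf :: "nat \<Rightarrow> nat \<Rightarrow> nat \<Rightarrow> (clause list \<times> clause list) pmf" where
  "instance_pmf n m3 m2 = pair_pmf (replicate_pmf m3 (pmf_of_set (clauses n 3)))
     (replicate_pmf m2 (pmf_of_set (clauses n 2)))"

definition triple_lists :: "nat set \<Rightarrow> nat \<Rightarrow> clause list set" where
  "triple_lists K r = {zs. set zs \<subseteq> {C. C \<subseteq> lits K \<and> card C = 3} \<and> length zs = r}"

lemma finite_triple_lists: "finite K \<Longrightarrow> finite (triple_lists K r)"
  unfolding triple_lists_def by (intro finite_lists_length_eq) (simp add: finite_lits)

lemma card_triple_lists: "finite K \<Longrightarrow> card (triple_lists K r) = (2 * card K choose 3) ^ r"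
  unfolding triple_lists_def
  by (subst card_lists_length_eq) (simp_all add: finite_lits n_subsets card_lits)

text \<open>Only the countable features of a core are kept. The event is empty for overlapping
  \<open>K\<close> and \<open>U\<close>, so the union bound can range over all pairs of
  sets.\<close>

definition has_core :: "nat set \<Rightarrow> nat set \<Rightarrow> nat \<Rightarrow> nat \<Rightarrow> (clause list \<times> clause list) set" where
  "has_core K U r t = (if K \<inter> U = {} then {xs. \<exists>zs\<in>triple_lists K r. subseq zs xs}
     \<times> {ys. \<exists>zs\<in>pair_lists (lits U) (lits K) t. subseq zs ys} else {})"

text \<open>Take the first occurrence of each element of \<open>T\<close>. An instance may repeat
  clauses, whereas the subformula is a set.\<close>

lemma ex_distinct_subseq:
  assumes "T \<subseteq> set xs"
  shows "\<exists>zs. subseq zs xs \<and> distinct zs \<and> set zs = T"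
  using assms
proof (induction xs arbitrary: T)
  case (Cons x xs)
  show ?case
  proof (cases "x \<in> T")
    case True
    obtain zs where "subseq zs xs" "distinct zs" "set zs = T - {x}"
      using Cons.IH[of "T - {x}"] Cons.prems by auto
    then have "subseq (x # zs) (x # xs)" "distinct (x # zs)" "set (x # zs) = T"
      using True by auto
    then show ?thesis by blast
  next
    case False
    then obtain zs where "subseq zs xs" "distinct zs" "set zs = T"
      using Cons.IH[of T] Cons.prems by auto
    then show ?thesis by (blast intro: list_emb_Cons)
  qed
qed auto

lemma unsat_has_core:
  assumes xs: "set xs \<subseteq> clauses n 3" and ys: "set ys \<subseteq> clauses n 2"
    and unsat: "\<not> satisfiable (set (xs @ ys))"
  obtains K U r g where "K \<subseteq> {..<n}" "U \<subseteq> {..<n}"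
    and "(xs, ys) \<in> has_core K U r (card U + g)"
    and "K \<noteq> {}" "card K \<le> card (Spine (set (xs @ ys)))"
    and "r \<le> length xs" "g \<le> length ys"
    and "card K + 1 \<le> g + r" "3 * card K \<le> 2 * g + 6 * r"
proof -
  let ?\<Phi> = "set (xs @ ys)"
  obtain \<Xi> where \<Xi>: "\<Xi> \<subseteq> ?\<Phi>" "min_unsat \<Xi>"
    using ex_min_unsat[OF _ unsat] by auto
  have fin\<Xi>: "finite \<Xi>" using \<Xi>(1) by (rule finite_subset) simp
  have cl: "inj_on var C \<and> (card C = 2 \<or> card C = 3)" if "C \<in> ?\<Phi>" for C
    using that xs ys by (auto simp: clauses_def)
  have finC: "finite C" if "C \<in> ?\<Phi>" for C
    using that xs ys by (auto intro: finite_clause)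
  let ?T2 = "{C \<in> \<Xi>. card C = 2}" and ?T3 = "{C \<in> \<Xi>. card C = 3}"
  obtain K U where KU: "K \<inter> U = {}" "K \<union> U = vars \<Xi>"
    and T3: "\<forall>C\<in>?T3. C \<subseteq> lits K"
    and T2: "\<forall>C\<in>?T2. C \<subseteq> lits K \<union> lits U"
    and one: "\<forall>l\<in>lits U. card {C \<in> ?T2. l \<in> C} = 1"
    and K: "K \<noteq> {}" and ut: "card U \<le> card ?T2"
    and tarsi: "card U + card K + 1 \<le> card ?T2 + card ?T3"
    and dg: "2 * card U + 3 * card K \<le> 2 * card ?T2 + 6 * card ?T3"
    by (rule min_unsat_core[OF fin\<Xi> \<Xi>(2) cl[OF subsetD[OF \<Xi>(1)]]])
  have T3xs: "?T3 \<subseteq> set xs" and T2ys: "?T2 \<subseteq> set ys"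
    using \<Xi>(1) xs ys by (auto simp: clauses_def)
  obtain zs3 where zs3: "subseq zs3 xs" "distinct zs3" "set zs3 = ?T3"
    using ex_distinct_subseq[OF T3xs] by blast
  obtain zs2 where zs2: "subseq zs2 ys" "distinct zs2" "set zs2 = ?T2"
    using ex_distinct_subseq[OF T2ys] by blast
  have len: "length zs3 = card ?T3" "length zs2 = card ?T2"
    using zs2 zs3 distinct_card by fastforce+
  have "zs3 \<in> triple_lists K (card ?T3)"
    using zs3 len T3 by (auto simp: triple_lists_def)
  moreover have "zs2 \<in> pair_lists (lits U) (lits K) (card ?T2)"
  proof -
    have "length (filter (\<lambda>C. l \<in> C) zs2) = 1" if "l \<in> lits U" for l
    proof -
      have "length (filter (\<lambda>C. l \<in> C) zs2) = card (set (filter (\<lambda>C. l \<in> C) zs2))"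
        using zs2(2) by (intro distinct_card[symmetric] distinct_filter)
      also have "set (filter (\<lambda>C. l \<in> C) zs2) = {C \<in> ?T2. l \<in> C}" using zs2(3) by auto
      finally show ?thesis using one that by simp
    qed
    then show ?thesis using zs2 len T2 by (auto simp: pair_lists_def)
  qed
  ultimately have "(xs, ys) \<in> has_core K U (card ?T3) (card ?T2)"
    using zs2 zs3 KU(1) by (auto simp: has_core_def)
  moreover have "vars \<Xi> \<subseteq> {..<n}"
    using \<Xi>(1) xs ys by (fastforce simp: vars_def clauses_def)
  then have "K \<subseteq> {..<n}" "U \<subseteq> {..<n}" "finite (vars \<Xi>)"
    using KU by (auto intro: finite_subset[of "vars \<Xi>" "{..<n}"])
  moreover have "card K \<le> card (Spine ?\<Phi>)"
  proof -
    have "card K \<le> card (vars \<Xi>)" using \<open>finite (vars \<Xi>)\<close> KU by (intro card_mono) auto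
    also have "\<dots> \<le> card (Spine ?\<Phi>)"
      using \<Xi> finC by (intro card_vars_le_card_Spine) auto
    finally show ?thesis .
  qed
  moreover have "card ?T3 \<le> length xs" "card ?T2 \<le> length ys"
    using len zs2 zs3 by (metis list_emb_length)+
  \<comment> \<open>\<open>g\<close> is the excess of 2-clauses over non-core variables; by
    \<open>ut\<close> the subtraction is exact.\<close>
  ultimately show ?thesis
    using that[of K U "card ?T3" "card ?T2 - card U"] K ut tarsi dg by simp
qed

lemma clauses_nonempty:
  assumes "n \<ge> k"
  shows "clauses n k \<noteq> {}"
proof -
  have "0 < (n choose k) * 2 ^ k" using assms by simp
  then have "0 < card (clauses n k)" using card_clauses_ge[of n k] by linarith
  then show ?thesis by auto
qed

text \<open>By independence the bound is a product of two subsequence bounds, one for each clause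
  length.\<close>

lemma prob_has_core_le:
  assumes n: "n \<ge> 3" and K: "K \<subseteq> {..<n}" and U: "U \<subseteq> {..<n}"
  shows "measure_pmf.prob (instance_pmf n m3 m2) (has_core K U r (card U + g))
    \<le> real (m3 choose r) * real (2 * card K choose 3) ^ r / (8 * real (n choose 3)) ^ r
      * (real (m2 choose (card U + g)) * (fact (2 * (card U + g)) / fact (2 * g)
          * (2 * real (card K)) ^ (2 * g) / 2 ^ (card U + g))
         / (4 * real (n choose 2)) ^ (card U + g))"
    (is "_ \<le> ?R3 * ?R2")
proof (cases "K \<inter> U = {}")
  case True
  let ?t = "card U + g" and ?c = "\<lambda>j. card (clauses n j)"
  have fin: "finite K" "finite U" using K U finite_subset by blast+
  have c3: "8 * real (n choose 3) \<le> real (?c 3)"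
    using of_nat_mono[OF card_clauses_ge[of n 3], where ?'a = real] by simp
  have c2: "4 * real (n choose 2) \<le> real (?c 2)"
    using of_nat_mono[OF card_clauses_ge[of n 2], where ?'a = real] by simp
  have pos: "0 < real (n choose 3)" "0 < real (n choose 2)" using n by auto
  have ne: "clauses n 3 \<noteq> {}" "clauses n 2 \<noteq> {}"
    using n by (auto intro!: clauses_nonempty)
  have "measure_pmf.prob (replicate_pmf m3 (pmf_of_set (clauses n 3)))
        {xs. \<exists>zs\<in>triple_lists K r. subseq zs xs}
      \<le> real (m3 choose r) * real (card (triple_lists K r)) / real (?c 3) ^ r"
    using finite_clauses ne finite_triple_lists[OF fin(1)]
    by (intro prob_ex_subseq_le) (auto simp: triple_lists_def)
  also have "\<dots> \<le> ?R3"
    unfolding card_triple_lists[OF fin(1)] using c3 pos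
    by (intro frac_le power_mono) auto
  finally have p3: "measure_pmf.prob (replicate_pmf m3 (pmf_of_set (clauses n 3)))
        {xs. \<exists>zs\<in>triple_lists K r. subseq zs xs} \<le> ?R3" .
  let ?P = "pair_lists (lits U) (lits K) ?t"
  have "card ?P * 2 ^ ?t \<le> marked_words (card (lits K)) (2 * ?t) (card (lits U))"
    using True fin by (intro card_pair_lists_le finite_lits) (auto simp: lits_def)
  also have "\<dots> = (2 * ?t choose (2 * card U)) * fact (2 * card U) * (2 * card K) ^ (2 * g)"
    using fin by (simp add: marked_words_def card_lits)
  finally have "real (card ?P * 2 ^ ?t)
      \<le> real ((2 * ?t choose (2 * card U)) * fact (2 * card U) * (2 * card K) ^ (2 * g))"
    by (rule of_nat_mono)
  also have "\<dots> = fact (2 * ?t) / fact (2 * g) * (2 * real (card K)) ^ (2 * g)"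
    using binomial_fact[of "2 * card U" "2 * ?t", where ?'a = real] by simp
  finally have cP: "real (card ?P)
      \<le> fact (2 * ?t) / fact (2 * g) * (2 * real (card K)) ^ (2 * g) / 2 ^ ?t"
    by (simp add: field_simps)
  have "measure_pmf.prob (replicate_pmf m2 (pmf_of_set (clauses n 2)))
        {ys. \<exists>zs\<in>?P. subseq zs ys}
      \<le> real (m2 choose ?t) * real (card ?P) / real (?c 2) ^ ?t"
    using finite_clauses ne fin
    by (intro prob_ex_subseq_le finite_pair_lists) (auto simp: pair_lists_def finite_lits)
  also have "\<dots> \<le> ?R2"
    using c2 pos cP by (intro frac_le power_mono mult_left_mono) auto
  finally have p2: "measure_pmf.prob (replicate_pmf m2 (pmf_of_set (clauses n 2)))
        {ys. \<exists>zs\<in>?P. subseq zs ys} \<le> ?R2" .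
  show ?thesis
    unfolding has_core_def instance_pmf_def if_P[OF True] prob_pair_pmf_Times
    using p2 p3 by (intro mult_mono) simp_all
qed (simp add: has_core_def)

lemma set_instance_pmf:
  assumes "n \<ge> 3" "(xs, ys) \<in> set_pmf (instance_pmf n m3 m2)"
  shows "set xs \<subseteq> clauses n 3" "set ys \<subseteq> clauses n 2" "length xs = m3" "length ys = m2"
  using assms clauses_nonempty[of 3 n] clauses_nonempty[of 2 n]
  by (auto simp: instance_pmf_def set_replicate_pmf finite_clauses)

text \<open>A union bound over all profiles and all \<open>K\<close>, \<open>U\<close>. A spine
  below \<open>n / (512 * M)\<close> makes the core small enough for
  \<open>profile_bound_le\<close>, and summing over profiles leaves \<open>O(1 / n)\<close>.\<close>

lemma prob_unsat_small_Spine_le: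
  assumes n: "n \<ge> 4" and m3: "real m3 \<le> A * real n" and A: "0 \<le> A"
    and \<beta>: "0 < \<beta>" "\<beta> < 1" and m2: "real m2 \<le> \<beta> * (real n - 1)"
  defines "M \<equiv> exp 12 * (1 + 4 * A) * (8 / (1 - \<beta>)) ^ 3"
  shows "measure_pmf.prob (instance_pmf n m3 m2)
      {(xs, ys). \<not> satisfiable (set (xs @ ys))
         \<and> real (card (Spine (set (xs @ ys)))) < 1 / (512 * M) * real n}
    \<le> 32768 * M / (1 - \<beta>) / real n"
proof -
  let ?P = "instance_pmf n m3 m2"
  define E where "E = {(xs, ys). \<not> satisfiable (set (xs @ ys))
         \<and> real (card (Spine (set (xs @ ys)))) < 1 / (512 * M) * real n}"
  \<comment> \<open>A crude common bound on all parameters, used to make the index set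
    finite.\<close>
  define N where "N = n + m3 + m2"
  define I where "I = {(k, u, r, g). k \<le> N \<and> u \<le> N \<and> r \<le> N \<and> g \<le> N \<and>
     1 \<le> k \<and> k + 1 \<le> g + r \<and> 3 * k \<le> 2 * g + 6 * r \<and> M * real k / real n \<le> 1 / 512}"
  define D where "D j = {S. S \<subseteq> {..<n} \<and> card S = j}" for j :: nat
  have finD: "finite (D j)" for j by (simp add: D_def)
  have cardD: "card (D j) = n choose j" for j
    using n_subsets[of "{..<n}" j] by (simp add: D_def)
  have IN: "I \<subseteq> {..N} \<times> {..N} \<times> {..N} \<times> {..N}" by (auto simp: I_def)
  then have finI: "finite I" by (rule finite_subset) simp
  have M0: "0 < M" using A \<beta> by (simp add: M_def)
  let ?F = "\<lambda>(k, u, r, g). \<Union>(K, U)\<in>D k \<times> D u. has_core K U r (u + g)"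
  have sub: "E \<inter> set_pmf ?P \<subseteq> (\<Union>i\<in>I. ?F i)"
  proof
    fix z assume z: "z \<in> E \<inter> set_pmf ?P"
    obtain xs ys where xy: "z = (xs, ys)" by (cases z)
    have len: "set xs \<subseteq> clauses n 3" "set ys \<subseteq> clauses n 2" "length xs = m3" "length ys = m2"
      using set_instance_pmf[of n xs ys m3 m2] n z by (auto simp: xy)
    have unsat: "\<not> satisfiable (set (xs @ ys))"
      and sp: "real (card (Spine (set (xs @ ys)))) < 1 / (512 * M) * real n"
      using z by (auto simp: E_def xy)
    obtain K U r g where KU: "K \<subseteq> {..<n}" "U \<subseteq> {..<n}"
      and core: "(xs, ys) \<in> has_core K U r (card U + g)"
      and K: "K \<noteq> {}" "card K \<le> card (Spine (set (xs @ ys)))"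
      and rg: "r \<le> length xs" "g \<le> length ys"
      and h: "card K + 1 \<le> g + r" "3 * card K \<le> 2 * g + 6 * r"
      using unsat_has_core[OF len(1,2) unsat] by blast
    have cn: "card K \<le> n" "card U \<le> n"
      using KU card_mono[of "{..<n}"] by fastforce+
    have "real (card K) \<le> 1 / (512 * M) * real n" using K sp by linarith
    then have "M * real (card K) / real n \<le> 1 / 512"
      using M0 n by (simp add: field_simps)
    moreover have "1 \<le> card K"
      using K KU finite_subset[of K "{..<n}"] by (simp add: Suc_le_eq card_gt_0_iff)
    ultimately have "(card K, card U, r, g) \<in> I"
      using cn rg h len by (auto simp: I_def N_def)
    moreover have "z \<in> ?F (card K, card U, r, g)"
      using KU core by (auto simp: D_def xy)
    ultimately show "z \<in> (\<Union>i\<in>I. ?F i)" by blast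
  qed
  have "measure_pmf.prob ?P E = measure_pmf.prob ?P (E \<inter> set_pmf ?P)"
    by (simp add: measure_Int_set_pmf)
  also have "\<dots> \<le> measure_pmf.prob ?P (\<Union>i\<in>I. ?F i)"
    using sub by (intro measure_pmf.finite_measure_mono) auto
  also have "\<dots> \<le> (\<Sum>i\<in>I. measure_pmf.prob ?P (?F i))"
    using finI by (intro measure_UNION_le) auto
  also have "\<dots> \<le> (\<Sum>i\<in>I. case i of (k, u, r, g) \<Rightarrow> 2048 * M / real n *
      (((1 + \<beta>) / 2) ^ u * (1 / 2) ^ k * (1 / 2) ^ r * (1 / 2) ^ g))"
  proof (intro sum_mono, clarify)
    fix k u r g assume i: "(k, u, r, g) \<in> I"
    let ?b = "(real (m3 choose r) * real (2 * k choose 3) ^ r / (8 * real (n choose 3)) ^ r)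
     * (real (m2 choose (u + g)) * (fact (2 * (u + g)) / fact (2 * g) * (2 * real k) ^ (2 * g) / 2 ^ (u + g))
         / (4 * real (n choose 2)) ^ (u + g))"
    have "measure_pmf.prob ?P (\<Union>(K, U)\<in>D k \<times> D u. has_core K U r (u + g))
        \<le> (\<Sum>p\<in>D k \<times> D u. measure_pmf.prob ?P (case p of (K, U) \<Rightarrow> has_core K U r (u + g)))"
      using finD by (intro measure_UNION_le) auto
    also have "\<dots> \<le> (\<Sum>p\<in>D k \<times> D u. ?b)"
    proof (intro sum_mono)
      fix p assume p: "p \<in> D k \<times> D u"
      obtain K U where KU: "p = (K, U)" by (cases p)
      show "measure_pmf.prob ?P (case p of (K, U) \<Rightarrow> has_core K U r (u + g)) \<le> ?b"
        using prob_has_core_le[of n K U m3 m2 r g] n p by (auto simp: KU D_def)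
    qed
    also have "\<dots> = profile_bound n m3 m2 k u r g"
      by (simp add: card_cartesian_product cardD profile_bound_def)
    also have "\<dots> \<le> 2048 * M / real n * (((1 + \<beta>) / 2) ^ u * (1 / 2) ^ k * (1 / 2) ^ r * (1 / 2) ^ g)"
      unfolding M_def
      by (rule profile_bound_le[OF n m3 A \<beta> m2]) (use i in \<open>auto simp: I_def M_def\<close>)
    finally show "measure_pmf.prob ?P (\<Union>(K, U)\<in>D k \<times> D u. has_core K U r (u + g))
      \<le> 2048 * M / real n * (((1 + \<beta>) / 2) ^ u * (1 / 2) ^ k * (1 / 2) ^ r * (1 / 2) ^ g)" .
  qed
  also have "\<dots> = 2048 * M / real n * (\<Sum>(k, u, r, g)\<in>I.
      ((1 + \<beta>) / 2) ^ u * (1 / 2) ^ k * (1 / 2) ^ r * (1 / 2) ^ g)"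
    by (simp add: sum_distrib_left case_prod_unfold)
  also have "\<dots> \<le> 2048 * M / real n * (\<Sum>(k, u, r, g)\<in>{..N} \<times> {..N} \<times> {..N} \<times> {..N}.
      ((1 + \<beta>) / 2) ^ u * (1 / 2) ^ k * (1 / 2) ^ r * (1 / 2) ^ g)"
    using IN M0 \<beta> by (intro mult_left_mono sum_mono2) auto
  also have "\<dots> \<le> 2048 * M / real n * (8 / (1 - (1 + \<beta>) / 2))"
    using M0 \<beta> by (intro mult_left_mono sum_profiles_le) auto
  \<comment> \<open>\<open>8 / (1 - (1 + \<beta>) / 2) = 16 / (1 - \<beta>)\<close>, and
    \<open>2048 * 16 = 32768\<close>.\<close>
  also have "\<dots> = 32768 * M / (1 - \<beta>) / real n"
    using \<beta> n by (simp add: field_simps)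
  finally show ?thesis unfolding E_def .
qed

section \<open>Monotonicity in the number of clauses\<close>

lemma random_instance_eq:
  "random_instance p n m = map_pmf (\<lambda>(xs, ys). xs @ ys)
     (instance_pmf n (nat \<lfloor>p * real m\<rfloor>) (m - nat \<lfloor>p * real m\<rfloor>))"
  by (simp add: random_instance_def instance_pmf_def Let_def)

lemma map_take_replicate_pmf:
  assumes "a \<le> b"
  shows "map_pmf (take a) (replicate_pmf b p) = replicate_pmf a p"
  using assms
proof (induction b arbitrary: a)
  case (Suc b)
  show ?case
  proof (cases a)
    case 0
    then show ?thesis by (simp add: map_pmf_const)
  next
    case (Suc a')
    have "map_pmf (take a) (replicate_pmf (Suc b) p)
        = p \<bind> (\<lambda>x. map_pmf (take a') (replicate_pmf b p) \<bind> (\<lambda>xs. return_pmf (x # xs)))"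
      by (simp add: Suc map_bind_pmf bind_map_pmf)
    also have "map_pmf (take a') (replicate_pmf b p) = replicate_pmf a' p"
      using Suc Suc.prems by (intro Suc.IH) auto
    finally show ?thesis by (simp add: Suc)
  qed
qed simp

text \<open>Coupling: the smaller instance consists of prefixes of the two sample lists of the
  larger one. This requires both clause numbers to be monotone in \<open>m\<close> despite
  rounding.\<close>

lemma random_instance_mono:
  assumes n: "n \<ge> 3" and p: "0 \<le> p" "p \<le> 1" and m: "m \<le> m'"
    and mono: "\<And>\<Phi> \<Psi>. \<Phi> \<in> E \<Longrightarrow> set \<Phi> \<subseteq> set \<Psi> \<Longrightarrow> \<forall>C\<in>set \<Psi>. finite C \<Longrightarrow> \<Psi> \<in> E"
  shows "measure_pmf.prob (random_instance p n m) E \<le> measure_pmf.prob (random_instance p n m') E"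
proof -
  define k l k' l' where "k = nat \<lfloor>p * real m\<rfloor>" and "l = m - k"
    and "k' = nat \<lfloor>p * real m'\<rfloor>" and "l' = m' - k'"
  have kk: "k \<le> k'" unfolding k_def k'_def
    using m p by (intro nat_mono floor_mono mult_left_mono) auto
  \<comment> \<open>As \<open>p \<le> 1\<close>, raising \<open>m\<close> by an integer raises the
    floor of \<open>p * m\<close> by at most that integer.\<close>
  have ll: "l \<le> l'"
  proof -
    have "p * real m' - p * real m \<le> 1 * (real m' - real m)"
      using mult_right_mono[OF p(2), of "real m' - real m"] m by (simp add: algebra_simps)
    then have "p * real m' \<le> p * real m + of_int (int m' - int m)" by simp
    then have "\<lfloor>p * real m'\<rfloor> \<le> \<lfloor>p * real m + of_int (int m' - int m)\<rfloor>" by (rule floor_mono)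
    then have "\<lfloor>p * real m'\<rfloor> \<le> \<lfloor>p * real m\<rfloor> + (int m' - int m)"
      by (simp only: floor_add_int)
    moreover have "0 \<le> \<lfloor>p * real m\<rfloor>" using p by simp
    ultimately show ?thesis using m unfolding l_def l'_def k_def k'_def by linarith
  qed
  let ?r = "\<lambda>j m. replicate_pmf j (pmf_of_set (clauses n m))"
  have "instance_pmf n k l = map_pmf (map_prod (take k) (take l)) (instance_pmf n k' l')"
    unfolding instance_pmf_def map_prod_def map_pair
    by (simp add: map_take_replicate_pmf[OF kk] map_take_replicate_pmf[OF ll])
  then have "measure_pmf.prob (random_instance p n m) E
      = measure_pmf.prob (instance_pmf n k' l') {(xs, ys). take k xs @ take l ys \<in> E}"
    by (auto simp: random_instance_eq k_def l_def intro!: arg_cong[where f = "measure _"])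
  also have "\<dots> = measure_pmf.prob (instance_pmf n k' l')
      ({(xs, ys). take k xs @ take l ys \<in> E} \<inter> set_pmf (instance_pmf n k' l'))"
    by (simp add: measure_Int_set_pmf)
  also have "\<dots> \<le> measure_pmf.prob (instance_pmf n k' l') {(xs, ys). xs @ ys \<in> E}"
  proof (intro measure_pmf.finite_measure_mono subsetI)
    fix z assume z: "z \<in> {(xs, ys). take k xs @ take l ys \<in> E} \<inter> set_pmf (instance_pmf n k' l')"
    obtain xs ys where xy: "z = (xs, ys)" by (cases z)
    have "xs @ ys \<in> E"
    proof (rule mono)
      show "take k xs @ take l ys \<in> E" using z xy by simp
      show "set (take k xs @ take l ys) \<subseteq> set (xs @ ys)" by (auto dest: in_set_takeD)
      show "\<forall>C\<in>set (xs @ ys). finite C"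
        using set_instance_pmf(1,2)[of n xs ys k' l'] n z xy by (auto intro: finite_clause)
    qed
    then show "z \<in> {(xs, ys). xs @ ys \<in> E}" using xy by simp
  qed simp
  also have "\<dots> = measure_pmf.prob (random_instance p n m') E"
    by (auto simp: random_instance_eq k'_def l'_def intro!: arg_cong[where f = "measure _"])
  finally show ?thesis .
qed

lemma prob_not: "measure_pmf.prob q {x. \<not> P x} = 1 - measure_pmf.prob q {x. P x}"
  using measure_pmf.prob_compl[of "{x. P x}" q] by (simp add: Collect_neg_eq Compl_eq_Diff_UNIV)

text \<open>Truncating \<open>m\<close> at the threshold \<open>m1 = c n\<close> of the hypothesis keeps the instance
  unsatisfiable and can only shrink the spine, while the 2-clauses become subcritical.\<close>

(* For p = 1 the bound (1 - \<epsilon>) / (1 - p) is read as infinity, i.e. c is unconstrained. *)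
theorem theorem6:
  fixes p :: real
  assumes "p \<in> {0..1}"
    and "\<exists>\<epsilon>>0. \<exists>c::real. (p < 1 \<longrightarrow> c < (1 - \<epsilon>) / (1 - p)) \<and>
           (\<lambda>n. measure_pmf.prob (random_instance p n (nat \<lfloor>c * real n\<rfloor>))
                   {\<Phi>. \<not> satisfiable (set \<Phi>)}) \<longlonglongrightarrow> 1"
  shows "first_order_phase_transition p"
proof -
  from assms(1) have p: "0 \<le> p" "p \<le> 1" by auto
  from assms(2) obtain \<epsilon> c :: real where "\<epsilon> > 0" and c: "p < 1 \<longrightarrow> c < (1 - \<epsilon>) / (1 - p)"
    and lim_c: "(\<lambda>n. measure_pmf.prob (random_instance p n (nat \<lfloor>c * real n\<rfloor>))
                   {\<Phi>. \<not> satisfiable (set \<Phi>)}) \<longlonglongrightarrow> 1" by blast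
  \<comment> \<open>The maximum covers negative \<open>c\<close>, where \<open>m1 n = 0\<close>. Up
    to rounding, \<open>b * n\<close> bounds the number of 2-clauses at the threshold, and
    \<open>\<beta>\<close> lies halfway between \<open>b\<close> and 1 to absorb the
    rounding.\<close>
  define A where "A = max c 0"
  define b where "b = (1 - p) * A"
  define \<beta> where "\<beta> = (1 + b) / 2"
  define m1 where "m1 n = nat \<lfloor>c * real n\<rfloor>" for n :: nat
  have A: "0 \<le> A" by (simp add: A_def)
  have b: "0 \<le> b" "b < 1"
  proof -
    show "0 \<le> b" using A p by (simp add: b_def)
    \<comment> \<open>The hypothesis on \<open>c\<close> says precisely that the 2-clauses are
      subcritical; for \<open>p = 1\<close> there is no linear amount of them.\<close>
    show "b < 1"
    proof (cases "p < 1")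
      case True
      then have "c * (1 - p) < 1 - \<epsilon>" using c by (simp add: pos_less_divide_eq)
      then have "c * (1 - p) < 1" using \<open>\<epsilon> > 0\<close> by linarith
      then show ?thesis by (simp add: b_def A_def max_def mult.commute)
    qed (use p in \<open>simp add: b_def\<close>)
  qed
  have \<beta>: "0 < \<beta>" "\<beta> < 1" using b by (auto simp: \<beta>_def)
  define M where "M = exp 12 * (1 + 4 * A) * (8 / (1 - \<beta>)) ^ 3"
  \<comment> \<open>Depends only on \<open>p\<close> and \<open>c\<close>, hence is uniform over all
    sequences \<open>m\<close>.\<close>
  define \<eta> where "\<eta> = 1 / (512 * M)"
  have M0: "0 < M" using A \<beta> by (simp add: M_def)
  have \<eta>0: "0 < \<eta>" using M0 by (simp add: \<eta>_def)
  have m1_le: "real (m1 n) \<le> A * real n" for n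
  proof -
    have "real (m1 n) \<le> max (c * real n) 0" unfolding m1_def by linarith
    also have "\<dots> \<le> A * real n" by (auto simp: A_def mult_right_mono)
    finally show ?thesis .
  qed
  show ?thesis
    unfolding first_order_phase_transition_def
  proof (intro exI[of _ \<eta>] conjI allI impI \<eta>0)
    fix m :: "nat \<Rightarrow> nat"
    let ?sat = "\<lambda>n m. measure_pmf.prob (random_instance p n m) {\<Phi>. satisfiable (set \<Phi>)}"
    let ?spine = "\<lambda>n m. measure_pmf.prob (random_instance p n m)
        {\<Phi>. real (card (Spine (set \<Phi>))) / real n \<ge> \<eta>}"
    assume lim_m: "(\<lambda>n. ?sat n (m n)) \<longlonglongrightarrow> 0"
    define w where "w n = min (m n) (m1 n)" for n
    have lim_m1: "(\<lambda>n. ?sat n (m1 n)) \<longlonglongrightarrow> 0"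
      using tendsto_diff[OF tendsto_const[of 1] lim_c] by (simp add: prob_not m1_def)
    \<comment> \<open>For each \<open>n\<close> the value \<open>w n\<close> is one of
      \<open>m n\<close> and \<open>m1 n\<close>; adding both probabilities avoids a case split
      along the sequence.\<close>
    have sat_w: "?sat n (w n) \<le> ?sat n (m n) + ?sat n (m1 n)" for n
      by (auto simp: w_def min_def)
    have bad_w: "\<forall>\<^sub>F n in sequentially. 1 - (?sat n (w n) + 32768 * M / (1 - \<beta>) / real n) \<le> ?spine n (w n)"
    proof -
      \<comment> \<open>Since \<open>\<beta> - b = (1 - b) / 2\<close>, this is the size of
        \<open>n\<close> from which \<open>b * n + 1 \<le> \<beta> * (n - 1)\<close>; the
        \<open>+ 1\<close> is the rounding error in the number of 2-clauses.\<close>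
      have "\<forall>\<^sub>F n :: nat in sequentially. n \<ge> max 4 (nat \<lceil>(2 + 2 * \<beta>) / (1 - b)\<rceil>)"
        by (rule eventually_ge_at_top)
      then show ?thesis
      proof (rule eventually_mono)
        fix n assume n: "n \<ge> max 4 (nat \<lceil>(2 + 2 * \<beta>) / (1 - b)\<rceil>)"
        let ?k = "nat \<lfloor>p * real (w n)\<rfloor>"
        let ?l = "w n - ?k"
        have n4: "n \<ge> 4" using n by simp
        have wA: "real (w n) \<le> A * real n" using m1_le[of n] by (simp add: w_def min_def)
        have pw: "p * real (w n) \<le> real (w n)" using p mult_right_mono[of p 1 "real (w n)"] by simp
        have k: "real ?k \<le> p * real (w n)" "p * real (w n) < real ?k + 1" using p by (auto simp: of_nat_nat)
        have kw: "?k \<le> w n" using k(1) pw by linarith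
        have m3: "real ?k \<le> A * real n" using k pw wA by linarith
        have "(2 + 2 * \<beta>) / (1 - b) \<le> real n" using n by linarith
        then have "2 + 2 * \<beta> \<le> real n * (1 - b)" using b by (simp add: field_simps)
        then have large: "b * real n + 1 \<le> \<beta> * (real n - 1)"
          by (simp add: \<beta>_def field_simps)
        have "real ?l = real (w n) - real ?k" using kw by (simp add: of_nat_diff)
        also have "\<dots> \<le> (1 - p) * real (w n) + 1" using k by (simp add: algebra_simps)
        also have "\<dots> \<le> (1 - p) * (A * real n) + 1"
          using wA p by (intro add_right_mono mult_left_mono) auto
        also have "\<dots> = b * real n + 1" by (simp add: b_def)
        finally have m2: "real ?l \<le> \<beta> * (real n - 1)" using large by linarith
        let ?I = "instance_pmf n ?k ?l"
        let ?bad = "{(xs, ys). \<not> satisfiable (set (xs @ ys))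
           \<and> real (card (Spine (set (xs @ ys)))) < 1 / (512 * M) * real n}"
        let ?app = "\<lambda>(xs, ys). xs @ ys"
        have sp: "?spine n (w n) = 1 - measure_pmf.prob (random_instance p n (w n))
            {\<Phi>. \<not> real (card (Spine (set \<Phi>))) / real n \<ge> \<eta>}"
          by (simp add: prob_not)
        \<comment> \<open>A small spine occurs either with a satisfiable instance, which is unlikely
          at \<open>w n\<close>, or in the event bounded by the first moment.\<close>
        have "measure_pmf.prob (random_instance p n (w n))
            {\<Phi>. \<not> real (card (Spine (set \<Phi>))) / real n \<ge> \<eta>}
          \<le> measure_pmf.prob ?I (?app -` {\<Phi>. satisfiable (set \<Phi>)} \<union> ?bad)"
          unfolding random_instance_eq measure_map_pmf
        proof (intro measure_pmf.finite_measure_mono subsetI)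
          fix z assume z: "z \<in> ?app -` {\<Phi>. \<not> real (card (Spine (set \<Phi>))) / real n \<ge> \<eta>}"
          obtain xs ys where "z = (xs, ys)" by (cases z)
          then show "z \<in> ?app -` {\<Phi>. satisfiable (set \<Phi>)} \<union> ?bad"
            using z n4
            by (cases "satisfiable (set (xs @ ys))")
              (simp_all del: set_append add: \<eta>_def pos_divide_less_eq not_le)
        qed simp
        also have "\<dots> \<le> measure_pmf.prob ?I (?app -` {\<Phi>. satisfiable (set \<Phi>)})
            + measure_pmf.prob ?I ?bad"
          by (intro measure_Un_le) auto
        also have "measure_pmf.prob ?I (?app -` {\<Phi>. satisfiable (set \<Phi>)}) = ?sat n (w n)"
          unfolding random_instance_eq measure_map_pmf ..
        also have "measure_pmf.prob ?I ?bad \<le> 32768 * M / (1 - \<beta>) / real n"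
          unfolding M_def by (rule prob_unsat_small_Spine_le[OF n4 m3 A \<beta> m2])
        finally show "1 - (?sat n (w n) + 32768 * M / (1 - \<beta>) / real n) \<le> ?spine n (w n)"
          using sp by simp
      qed
    qed
    have spine_mono: "?spine n (w n) \<le> ?spine n (m n)" if "n \<ge> 3" for n
    proof (rule random_instance_mono[OF that p])
      show "w n \<le> m n" by (simp add: w_def)
      fix \<Phi> \<Psi> :: "clause list"
      assume \<Phi>: "\<Phi> \<in> {\<Phi>. real (card (Spine (set \<Phi>))) / real n \<ge> \<eta>}"
        and sub: "set \<Phi> \<subseteq> set \<Psi>" and fin: "\<forall>C\<in>set \<Psi>. finite C"
      have "card (Spine (set \<Phi>)) \<le> card (Spine (set \<Psi>))"
        using sub fin by (intro card_mono Spine_mono finite_Spine) auto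
      then have "real (card (Spine (set \<Phi>))) / real n \<le> real (card (Spine (set \<Psi>))) / real n"
        by (intro divide_right_mono) auto
      then show "\<Psi> \<in> {\<Phi>. real (card (Spine (set \<Phi>))) / real n \<ge> \<eta>}" using \<Phi> by simp
    qed
    show "(\<lambda>n. ?spine n (m n)) \<longlonglongrightarrow> 1"
    proof (rule tendsto_sandwich)
      show "\<forall>\<^sub>F n in sequentially.
          1 - (?sat n (m n) + ?sat n (m1 n) + 32768 * M / (1 - \<beta>) / real n) \<le> ?spine n (m n)"
        using bad_w eventually_ge_at_top[of 3]
      proof eventually_elim
        fix n :: nat assume "n \<ge> 3" "1 - (?sat n (w n) + 32768 * M / (1 - \<beta>) / real n) \<le> ?spine n (w n)"
        then show "1 - (?sat n (m n) + ?sat n (m1 n) + 32768 * M / (1 - \<beta>) / real n) \<le> ?spine n (m n)"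
          using sat_w[of n] spine_mono[of n] by linarith
      qed
      show "\<forall>\<^sub>F n in sequentially. ?spine n (m n) \<le> 1" by simp
      have "(\<lambda>n. 1 - (?sat n (m n) + ?sat n (m1 n) + 32768 * M / (1 - \<beta>) / real n)) \<longlonglongrightarrow> 1 - (0 + 0 + 0)"
        by (intro tendsto_intros lim_m lim_m1 lim_const_over_n)
      then show "(\<lambda>n. 1 - (?sat n (m n) + ?sat n (m1 n) + 32768 * M / (1 - \<beta>) / real n)) \<longlonglongrightarrow> 1"
        by simp
    qed simp
  qed
qed

end
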